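(* Let $f:[0,1]\to[0,1]$ be a Lebesgue-measure-preserving map that is piecewise continuously differentiable with finitely many pieces and has bounded derivative, and let $\mu=\mu_f$ be the permuton induced by $f$. Then $$\lim_{n\to\infty}\frac{H_n(\mu)}{n}=h_{KS}(f),$$ where $h_{KS}(f)$ is the Kolmogorov--Sinai (measure-theoretic) entropy of $f$ with respect to the Lebesgue measure.
   Context: A permuton is a Borel probability measure on $[0,1]^2$ with uniform marginals. For a map $f:[0,1]\to[0,1]$ preserving the Lebesgue measure $\lambda$, the permuton $\mu_f$ is defined by $\mu_f(A\times B)=\lambda(A\cap f^{-1}(B))$. Piecewise continuously differentiable with finitely many pieces means that $[0,1]$ can be partitioned into finitely many intervals on the interior of each of which $f$ is continuously differentiable ($f$ need not be continuous at the endpoints). For a permuton $\mu$ and $n\ge 1$, draw $n$ i.i.d. points from $\mu$ and read the relative order of their heights from left to right; this gives a random permutation whose distribution on $\mathrm{Sym}(n)$ is denoted $\mu^{(n)}$, and $H_n(\mu)$ is the Shannon entropy of $\mu^{(n)}$ (natural logarithm). *)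

theory Defs
  imports "HOL-Probability.Probability" "HOL-Combinatorics.Permutations"
begin

section \<open>Permutons\<close>

abbreviation unit_lborel :: "real measure" where
  "unit_lborel \<equiv> restrict_space lborel {0..1}"

abbreviation unit_square_borel :: "(real \<times> real) measure" where
  "unit_square_borel \<equiv> restrict_space borel ({0..1} \<times> {0..1})"

definition permuton :: "(real \<times> real) measure \<Rightarrow> bool" where
  "permuton \<mu> \<longleftrightarrow>
     sets \<mu> = sets unit_square_borel \<and> prob_space \<mu> \<and>
     distr \<mu> unit_lborel fst = unit_lborel \<and>
     distr \<mu> unit_lborel snd = unit_lborel"

definition measure_preserving :: "'a measure \<Rightarrow> ('a \<Rightarrow> 'a) \<Rightarrow> bool" where
  "measure_preserving M T \<longleftrightarrow> T \<in> M \<rightarrow>\<^sub>M M \<and> distr M M T = M"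

text \<open>The permuton induced by \<open>f\<close> is characterised by its values on measurable rectangles; see
  \<open>induced_permuton_exists\<close> and \<open>induced_permuton_unique\<close> below.\<close>

definition induced_permuton :: "(real \<Rightarrow> real) \<Rightarrow> (real \<times> real) measure \<Rightarrow> bool" where
  "induced_permuton f \<mu> \<longleftrightarrow> permuton \<mu> \<and>
     (\<forall>A\<in>sets unit_lborel. \<forall>B\<in>sets unit_lborel.
        emeasure \<mu> (A \<times> B) = emeasure unit_lborel (A \<inter> f -` B))"

lemma space_unit_lborel: "space unit_lborel = {0..1}"
  by (simp add: space_restrict_space)

lemma prob_space_unit_lborel: "prob_space unit_lborel"
  by (rule prob_spaceI) (simp add: space_unit_lborel emeasure_restrict_space)

lemma sets_unit_square: "sets unit_square_borel = sets (unit_lborel \<Otimes>\<^sub>M unit_lborel)"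
proof (rule antisym)
  have "(\<lambda>x. x) \<in> unit_lborel \<rightarrow>\<^sub>M borel"
    by (intro measurable_restrict_space1) simp
  then have "(\<lambda>z. (fst z, snd z)) \<in> unit_lborel \<Otimes>\<^sub>M unit_lborel \<rightarrow>\<^sub>M borel \<Otimes>\<^sub>M borel"
    by measurable
  then have id: "(\<lambda>z. z) \<in> unit_lborel \<Otimes>\<^sub>M unit_lborel \<rightarrow>\<^sub>M unit_square_borel"
    by (intro measurable_restrict_space2)
      (auto simp: borel_prod space_pair_measure space_unit_lborel)
  show "sets unit_square_borel \<subseteq> sets (unit_lborel \<Otimes>\<^sub>M unit_lborel)"
  proof
    fix A assume A: "A \<in> sets unit_square_borel"
    have "A \<subseteq> {0..1} \<times> {0..1}"
      using sets.sets_into_space[OF A] by (simp add: space_restrict_space)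
    then have "A \<inter> space (unit_lborel \<Otimes>\<^sub>M unit_lborel) = A"
      by (auto simp: space_pair_measure space_unit_lborel)
    with measurable_sets[OF id A] show "A \<in> sets (unit_lborel \<Otimes>\<^sub>M unit_lborel)" by simp
  qed
  have "A \<times> B \<in> sets unit_square_borel" if "A \<in> sets unit_lborel" "B \<in> sets unit_lborel" for A B
  proof -
    have "A \<in> sets borel" "B \<in> sets borel" "A \<subseteq> {0..1}" "B \<subseteq> {0..1}"
      using that by (auto simp: sets_restrict_space_iff)
    then show ?thesis
      by (auto simp: sets_restrict_space_iff borel_Times)
  qed
  then have "{A \<times> B |A B. A \<in> sets unit_lborel \<and> B \<in> sets unit_lborel} \<subseteq> sets unit_square_borel"
    by blast
  then have "sigma_sets (space unit_square_borel)
      {A \<times> B |A B. A \<in> sets unit_lborel \<and> B \<in> sets unit_lborel} \<subseteq> sets unit_square_borel"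
    by (rule sets.sigma_sets_subset)
  moreover have "space unit_square_borel = space unit_lborel \<times> space unit_lborel"
    by (simp add: space_restrict_space)
  ultimately show "sets (unit_lborel \<Otimes>\<^sub>M unit_lborel) \<subseteq> sets unit_square_borel"
    unfolding sets_pair_measure by (simp only:)
qed

lemma induced_permuton_exists:
  assumes "measure_preserving unit_lborel f"
  shows "induced_permuton f (distr unit_lborel unit_square_borel (\<lambda>x. (x, f x)))"
proof -
  have f: "f \<in> unit_lborel \<rightarrow>\<^sub>M unit_lborel" and d: "distr unit_lborel unit_lborel f = unit_lborel"
    using assms by (auto simp: measure_preserving_def)
  have g0: "(\<lambda>x. (x, f x)) \<in> unit_lborel \<rightarrow>\<^sub>M unit_lborel \<Otimes>\<^sub>M unit_lborel"
    using f by measurable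
  have g: "(\<lambda>x. (x, f x)) \<in> unit_lborel \<rightarrow>\<^sub>M unit_square_borel"
    using g0 measurable_cong_sets[OF refl sets_unit_square] by blast
  have fst: "fst \<in> unit_square_borel \<rightarrow>\<^sub>M unit_lborel"
    by (subst measurable_cong_sets[OF sets_unit_square refl]) measurable
  have snd: "snd \<in> unit_square_borel \<rightarrow>\<^sub>M unit_lborel"
    by (subst measurable_cong_sets[OF sets_unit_square refl]) measurable
  have "prob_space (distr unit_lborel unit_square_borel (\<lambda>x. (x, f x)))"
    by (rule prob_space.prob_space_distr[OF prob_space_unit_lborel g])
  moreover have "distr (distr unit_lborel unit_square_borel (\<lambda>x. (x, f x))) unit_lborel fst = unit_lborel"
    by (subst distr_distr[OF fst g]) (simp add: comp_def distr_id)
  moreover have "distr (distr unit_lborel unit_square_borel (\<lambda>x. (x, f x))) unit_lborel snd = unit_lborel"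
    by (subst distr_distr[OF snd g]) (simp add: comp_def d)
  moreover have "emeasure (distr unit_lborel unit_square_borel (\<lambda>x. (x, f x))) (A \<times> B) =
      emeasure unit_lborel (A \<inter> f -` B)"
    if A: "A \<in> sets unit_lborel" and B: "B \<in> sets unit_lborel" for A B
  proof -
    have "A \<times> B \<in> sets unit_square_borel"
      using A B by (simp add: sets_unit_square)
    then have "emeasure (distr unit_lborel unit_square_borel (\<lambda>x. (x, f x))) (A \<times> B) =
        emeasure unit_lborel ((\<lambda>x. (x, f x)) -` (A \<times> B) \<inter> space unit_lborel)"
      by (rule emeasure_distr[OF g])
    also have "(\<lambda>x. (x, f x)) -` (A \<times> B) \<inter> space unit_lborel = A \<inter> f -` B"
      using sets.sets_into_space[OF A] by auto
    finally show ?thesis .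
  qed
  ultimately show ?thesis
    by (simp add: induced_permuton_def permuton_def)
qed

lemma induced_permuton_unique:
  assumes "induced_permuton f \<mu>" "induced_permuton f \<nu>"
  shows "\<mu> = \<nu>"
proof (rule measure_eqI_generator_eq_countable)
  let ?E = "{A \<times> B | A B. A \<in> sets unit_lborel \<and> B \<in> sets unit_lborel}"
  have space: "space unit_lborel = {0..1}" by (rule space_unit_lborel)
  show "Int_stable ?E" by (rule Int_stable_pair_measure_generator)
  show "?E \<subseteq> Pow ({0..1} \<times> {0..1})"
    using sets.sets_into_space[of _ unit_lborel] unfolding space by blast
  show "emeasure \<mu> X = emeasure \<nu> X" if "X \<in> ?E" for X
    using that assms by (auto simp: induced_permuton_def)
  show "sets \<mu> = sigma_sets ({0..1} \<times> {0..1}) ?E" "sets \<nu> = sigma_sets ({0..1} \<times> {0..1}) ?E"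
    using assms
    by (auto simp: induced_permuton_def permuton_def sets_unit_square sets_pair_measure space)
  show "{{0..1} \<times> {0..1}} \<subseteq> ?E"
    using sets.top[of unit_lborel] unfolding space by blast
  show "\<Union>{{0..1} \<times> {0..1::real}} = {0..1::real} \<times> {0..1}" by simp
  show "emeasure \<mu> a \<noteq> \<infinity>" if "a \<in> {{0..1} \<times> {0..1}}" for a
    using assms(1) prob_space.finite_measure[of \<mu>]
    by (simp add: induced_permuton_def permuton_def finite_measure.emeasure_finite)
  show "countable {{0..1} \<times> {0..1::real}}" by simp
qed


section \<open>Piecewise continuously differentiable maps\<close>

text \<open>No continuity is required at the endpoints of the pieces, unlike in
  \<^const>\<open>piecewise_C1_differentiable_on\<close>.\<close>

definition piecewise_C1 :: "(real \<Rightarrow> real) \<Rightarrow> bool" where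
  "piecewise_C1 f \<longleftrightarrow>
     (\<exists>P. finite P \<and> partition_on {0..1} P \<and>
          (\<forall>I\<in>P. is_interval I \<and> f C1_differentiable_on interior I))"

text \<open>For a piecewise C1 map this differs from boundedness on the interiors of the pieces only at the
  finitely many breakpoints, so the choice of partition does not matter.\<close>

definition bounded_derivative :: "(real \<Rightarrow> real) \<Rightarrow> bool" where
  "bounded_derivative f \<longleftrightarrow>
     bounded (deriv f ` {x \<in> {0<..<1}. f field_differentiable (at x)})"


section \<open>Shannon entropy of the sampled permutation\<close>

text \<open>Here \<open>0 * ln 0 = 0\<close>, as usual.\<close>

definition shannon_entropy :: "('i \<Rightarrow> real) \<Rightarrow> 'i set \<Rightarrow> real" where
  "shannon_entropy p I = - (\<Sum>i\<in>I. p i * ln (p i))"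

lemma shannon_entropy_eq_entropy:
  assumes "prob_space M" "finite I" "X \<in> M \<rightarrow>\<^sub>M count_space I"
  shows "shannon_entropy (\<lambda>i. measure M (X -` {i} \<inter> space M)) I =
    prob_space.entropy M (exp 1) (count_space I) X"
proof -
  interpret prob_space M by fact
  interpret information_space M "exp 1" by unfold_locales simp
  let ?p = "\<lambda>i. measure M (X -` {i} \<inter> space M)"
  have "distr M (count_space I) X = density (count_space I) (\<lambda>i. ennreal (?p i))"
  proof (rule measure_eqI_finite[OF _ _ \<open>finite I\<close>])
    fix a assume "a \<in> I"
    then have "{i \<in> I. i = a} = {a}" by auto
    then have 1: "emeasure (density (count_space I) (\<lambda>i. ennreal (?p i))) {a} = ennreal (?p a)"
      using \<open>a \<in> I\<close>
      by (simp add: emeasure_density nn_integral_count_space_finite assms(2) indicator_def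
          if_distrib[of "\<lambda>x. _ * x"] cong: if_cong)
    have 2: "emeasure (distr M (count_space I) X) {a} = ennreal (?p a)"
      using \<open>a \<in> I\<close> by (subst emeasure_distr[OF assms(3)]) (auto simp: emeasure_eq_measure)
    show "emeasure (distr M (count_space I) X) {a} =
        emeasure (density (count_space I) (\<lambda>i. ennreal (?p i))) {a}"
      by (simp only: 1 2)
  qed auto
  then have "distributed M (count_space I) X (\<lambda>i. ennreal (?p i))"
    using assms(3) by (auto simp: distributed_def)
  then have "entropy (exp 1) (count_space I) X = - (\<integral>i. ?p i * log (exp 1) (?p i) \<partial>count_space I)"
    by (rule entropy_distr) simp
  then show ?thesis
    by (simp add: shannon_entropy_def lebesgue_integral_count_space_finite assms(2) log_def)
qed

text \<open>\<open>rank_among n v j\<close> is the position of \<open>v j\<close> in increasing order among \<open>v 1, \<dots>, v n\<close>. Ties, which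
  have probability zero for samples from a permuton, are broken by the index, so that
  \<open>rank_among n v\<close> is a permutation of \<open>{1..n}\<close> in every case.\<close>

definition rank_among :: "nat \<Rightarrow> (nat \<Rightarrow> real) \<Rightarrow> nat \<Rightarrow> nat" where
  "rank_among n v j =
     (if j \<in> {1..n} then card {k \<in> {1..n}. v k < v j \<or> (v k = v j \<and> k \<le> j)} else j)"

text \<open>The pattern sends \<open>i\<close> to the rank of the height of the \<open>i\<close>-th point from the left.\<close>

definition pattern :: "nat \<Rightarrow> (nat \<Rightarrow> real \<times> real) \<Rightarrow> nat \<Rightarrow> nat" where
  "pattern n \<omega> = rank_among n (\<lambda>j. snd (\<omega> j)) \<circ> inv (rank_among n (\<lambda>j. fst (\<omega> j)))"

definition pattern_law :: "(real \<times> real) measure \<Rightarrow> nat \<Rightarrow> (nat \<Rightarrow> nat) measure" where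
  "pattern_law \<mu> n =
     distr (Pi\<^sub>M {1..n} (\<lambda>_. \<mu>)) (count_space {\<sigma>. \<sigma> permutes {1..n}}) (pattern n)"

definition pattern_entropy :: "(real \<times> real) measure \<Rightarrow> nat \<Rightarrow> real" where
  "pattern_entropy \<mu> n =
     shannon_entropy (\<lambda>\<sigma>. measure (pattern_law \<mu> n) {\<sigma>}) {\<sigma>. \<sigma> permutes {1..n}}"

lemma rank_among_permutes: "rank_among n v permutes {1..n}"
proof -
  let ?S = "\<lambda>j. {k \<in> {1..n}. v k < v j \<or> (v k = v j \<and> k \<le> j)}"
  have into: "rank_among n v j \<in> {1..n}" if j: "j \<in> {1..n}" for j
  proof -
    have "card (?S j) \<le> card {1..n}" by (intro card_mono) auto
    moreover have "card (?S j) > 0" using j by (subst card_gt_0_iff) auto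
    ultimately show ?thesis using j by (simp add: rank_among_def)
  qed
  have lt: "rank_among n v i < rank_among n v j"
    if "i \<in> {1..n}" "j \<in> {1..n}" "v i < v j \<or> (v i = v j \<and> i < j)" for i j
  proof -
    have "?S i \<subset> ?S j" using that by force
    then have "card (?S i) < card (?S j)" by (intro psubset_card_mono) auto
    then show ?thesis using that by (simp add: rank_among_def)
  qed
  have inj: "inj_on (rank_among n v) {1..n}"
  proof (rule inj_onI)
    fix i j assume ij: "i \<in> {1..n}" "j \<in> {1..n}" "rank_among n v i = rank_among n v j"
    show "i = j"
    proof (rule ccontr)
      assume "i \<noteq> j"
      then have "(v i < v j \<or> (v i = v j \<and> i < j)) \<or> (v j < v i \<or> (v j = v i \<and> j < i))"
        by auto
      then show False using lt[of i j] lt[of j i] ij by auto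
    qed
  qed
  have "rank_among n v ` {1..n} = {1..n}"
    by (rule endo_inj_surj[OF _ _ inj]) (use into in auto)
  with inj have "bij_betw (rank_among n v) {1..n} {1..n}" by (simp add: bij_betw_def)
  then show ?thesis
    by (rule bij_imp_permutes) (unfold rank_among_def, rule if_not_P)
qed

lemma pattern_permutes: "pattern n \<omega> permutes {1..n}"
  unfolding pattern_def
  by (intro permutes_compose[OF permutes_inv] rank_among_permutes)

lemma pattern_eq_iff:
  assumes "\<sigma> permutes {1..n}"
  shows "pattern n \<omega> = \<sigma> \<longleftrightarrow>
    (\<forall>j\<in>{1..n}. \<sigma> (rank_among n (\<lambda>j. fst (\<omega> j)) j) = rank_among n (\<lambda>j. snd (\<omega> j)) j)"
proof -
  let ?x = "rank_among n (\<lambda>j. fst (\<omega> j))" and ?y = "rank_among n (\<lambda>j. snd (\<omega> j))"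
  have x: "bij ?x" by (rule permutes_bij[OF rank_among_permutes])
  have "pattern n \<omega> = \<sigma> \<longleftrightarrow> ?y = \<sigma> \<circ> ?x"
  proof
    assume "pattern n \<omega> = \<sigma>"
    then have "\<sigma> \<circ> ?x = ?y \<circ> (inv ?x \<circ> ?x)" by (auto simp: pattern_def comp_assoc)
    then show "?y = \<sigma> \<circ> ?x" using x by (simp add: bij_is_inj)
  next
    assume "?y = \<sigma> \<circ> ?x"
    then have "pattern n \<omega> = \<sigma> \<circ> (?x \<circ> inv ?x)" by (simp add: pattern_def comp_assoc)
    then show "pattern n \<omega> = \<sigma>"
      using x bij_is_surj surj_iff[of ?x] by (metis comp_id)
  qed
  also have "\<dots> \<longleftrightarrow> (\<forall>j. \<sigma> (?x j) = ?y j)" by (auto simp: fun_eq_iff)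
  also have "\<dots> \<longleftrightarrow> (\<forall>j\<in>{1..n}. \<sigma> (?x j) = ?y j)"
    using permutes_not_in[OF assms] by (auto simp: rank_among_def)
  finally show ?thesis .
qed

lemma rank_among_measurable:
  assumes [measurable]: "\<And>k. k \<in> {1..n} \<Longrightarrow> (\<lambda>\<omega>. v \<omega> k) \<in> borel_measurable M" and "j \<in> {1..n}"
  shows "(\<lambda>\<omega>. rank_among n (v \<omega>) j) \<in> M \<rightarrow>\<^sub>M count_space UNIV"
proof -
  have eq: "rank_among n (v \<omega>) j =
      (\<Sum>k\<in>{1..n}. if v \<omega> k < v \<omega> j \<or> (v \<omega> k = v \<omega> j \<and> k \<le> j) then 1 else 0)" for \<omega>
    using assms(2) by (simp add: rank_among_def sum.If_cases Int_def)
  have [measurable]: "(\<lambda>\<omega>. v \<omega> j) \<in> borel_measurable M" using assms by simp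
  have "(\<lambda>\<omega>. \<Sum>k\<in>{1..n}. if v \<omega> k < v \<omega> j \<or> (v \<omega> k = v \<omega> j \<and> k \<le> j) then 1 else (0::nat))
      \<in> borel_measurable M"
  proof (rule borel_measurable_sum)
    fix k assume "k \<in> {1..n}"
    then have [measurable]: "(\<lambda>\<omega>. v \<omega> k) \<in> borel_measurable M" using assms by simp
    show "(\<lambda>\<omega>. if v \<omega> k < v \<omega> j \<or> (v \<omega> k = v \<omega> j \<and> k \<le> j) then 1 else (0::nat))
        \<in> borel_measurable M"
      by measurable
  qed
  then show ?thesis
    by (simp add: eq measurable_cong_sets[OF refl sets_borel_eq_count_space])
qed

lemma pattern_measurable:
  assumes "sets \<mu> = sets unit_square_borel"
  shows "pattern n \<in> Pi\<^sub>M {1..n} (\<lambda>_. \<mu>) \<rightarrow>\<^sub>M count_space {\<sigma>. \<sigma> permutes {1..n}}"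
proof (subst measurable_count_space_eq2, simp add: finite_permutations, intro conjI ballI)
  let ?M = "Pi\<^sub>M {1..n} (\<lambda>_. \<mu>)"
  have \<mu>: "id \<in> \<mu> \<rightarrow>\<^sub>M (borel :: (real \<times> real) measure)"
    by (subst measurable_cong_sets[OF assms refl]) (auto intro: measurable_restrict_space1)
  have fst: "fst \<in> borel_measurable \<mu>" and snd: "snd \<in> borel_measurable \<mu>"
    using measurable_compose[OF \<mu>, of fst borel] measurable_compose[OF \<mu>, of snd borel]
    by (simp_all add: borel_measurable_continuous_onI continuous_on_fst continuous_on_snd)
  have x: "(\<lambda>\<omega>. fst (\<omega> k)) \<in> borel_measurable ?M" and y: "(\<lambda>\<omega>. snd (\<omega> k)) \<in> borel_measurable ?M"
    if "k \<in> {1..n}" for k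
    by (rule measurable_compose[OF measurable_component_singleton[OF that]] fst snd)+
  show "pattern n \<in> space ?M \<rightarrow> {\<sigma>. \<sigma> permutes {1..n}}"
    using pattern_permutes by blast
  fix \<sigma> assume "\<sigma> \<in> {\<sigma>. \<sigma> permutes {1..n}}"
  then have "pattern n -` {\<sigma>} \<inter> space ?M = {\<omega> \<in> space ?M. \<forall>j\<in>{1..n}.
      \<sigma> (rank_among n (\<lambda>j. fst (\<omega> j)) j) = rank_among n (\<lambda>j. snd (\<omega> j)) j}"
    using pattern_eq_iff[of \<sigma> n] by blast
  also have "\<dots> \<in> sets ?M"
  proof (rule sets.sets_Collect_finite_All)
    fix j assume j: "j \<in> {1..n}"
    have [measurable]: "(\<lambda>\<omega>. rank_among n (\<lambda>j. fst (\<omega> j)) j) \<in> ?M \<rightarrow>\<^sub>M count_space UNIV"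
        "(\<lambda>\<omega>. rank_among n (\<lambda>j. snd (\<omega> j)) j) \<in> ?M \<rightarrow>\<^sub>M count_space UNIV"
      by (rule rank_among_measurable[OF x j] rank_among_measurable[OF y j]; simp)+
    show "{\<omega> \<in> space ?M. \<sigma> (rank_among n (\<lambda>j. fst (\<omega> j)) j) = rank_among n (\<lambda>j. snd (\<omega> j)) j} \<in> sets ?M"
      by measurable
  qed simp
  finally show "pattern n -` {\<sigma>} \<inter> space ?M \<in> sets ?M" .
qed

lemma pattern_entropy_eq_entropy:
  assumes "permuton \<mu>"
  shows "pattern_entropy \<mu> n =
    prob_space.entropy (Pi\<^sub>M {1..n} (\<lambda>_. \<mu>)) (exp 1)
      (count_space {\<sigma>. \<sigma> permutes {1..n}}) (pattern n)"
proof -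
  have m: "pattern n \<in> Pi\<^sub>M {1..n} (\<lambda>_. \<mu>) \<rightarrow>\<^sub>M count_space {\<sigma>. \<sigma> permutes {1..n}}"
    using assms by (intro pattern_measurable) (simp add: permuton_def)
  have "prob_space (Pi\<^sub>M {1..n} (\<lambda>_. \<mu>))"
    using assms by (intro prob_space_PiM) (simp add: permuton_def)
  moreover have "finite {\<sigma>. \<sigma> permutes {1..n}}" by (rule finite_permutations) simp
  ultimately show ?thesis
    using m by (subst shannon_entropy_eq_entropy[symmetric])
      (auto simp: pattern_entropy_def pattern_law_def shannon_entropy_def measure_distr
        intro!: sum.cong)
qed


section \<open>Kolmogorov--Sinai entropy\<close>

definition finite_partitions :: "'a measure \<Rightarrow> 'a set set set" where
  "finite_partitions M = {P. finite P \<and> P \<subseteq> sets M \<and> partition_on (space M) P}"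

text \<open>The join of the pullbacks of \<open>P\<close> under \<open>T ^^ k\<close> for \<open>k < n\<close>.\<close>

definition iterated_join :: "'a measure \<Rightarrow> ('a \<Rightarrow> 'a) \<Rightarrow> 'a set set \<Rightarrow> nat \<Rightarrow> 'a set set" where
  "iterated_join M T P n =
     {space M \<inter> (\<Inter>k<n. (T ^^ k) -` c k) | c. \<forall>k<n. c k \<in> P} - {{}}"

text \<open>The limit exists, by subadditivity, whenever \<open>T\<close> preserves the probability measure \<open>M\<close> and \<open>P\<close> is
  a finite measurable partition.\<close>

definition entropy_wrt_partition :: "'a measure \<Rightarrow> ('a \<Rightarrow> 'a) \<Rightarrow> 'a set set \<Rightarrow> real" where
  "entropy_wrt_partition M T P =
     lim (\<lambda>n. shannon_entropy (measure M) (iterated_join M T P n) / real n)"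

definition KS_entropy :: "'a measure \<Rightarrow> ('a \<Rightarrow> 'a) \<Rightarrow> ereal" where
  "KS_entropy M T = (SUP P \<in> finite_partitions M. ereal (entropy_wrt_partition M T P))"

end

theory Submission
  imports Defs "HOL-Real_Asymp.Real_Asymp"
begin

text \<open>
  Both sides of the limit are equal to one number, the entropy of the branch of \<open>f\<close> through a random
  point \<open>x\<close> given the value \<open>f x\<close> (\<open>branch_entropy\<close>). It is defined with finite partitions only,
  as the infimum over grids of the entropy of the branch of \<open>x\<close> given the grid cell of \<open>f x\<close>.

  A map that preserves Lebesgue measure cannot contract near a point, so \<open>\<bar>f'\<bar> \<ge> 1\<close> wherever \<open>f\<close> is
  differentiable in the open interval. Hence the unit interval splits into finitely many intervals, some
  of them single points, on each of which \<open>f\<close> is strictly monotone and does not decrease distances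
  (\<open>branched_map_if_piecewise_C1\<close>). Let \<open>X x\<close> be the number of the interval that contains \<open>x\<close>.

  \<^bold>\<open>Kolmogorov--Sinai entropy.\<close> By invariance of the measure, the entropy of the first \<open>n + 1\<close> values
  of \<open>X\<close> along an orbit exceeds that of the first \<open>n\<close> values by the entropy of \<open>X x\<close> given the \<open>n\<close>
  values along the orbit of \<open>f x\<close>. This is at least the entropy given \<open>f x\<close> itself, so the partition
  into branches has entropy at least \<open>branch_entropy\<close>. Conversely, the branches visited up to time
  \<open>n\<close> and the grid cell at time \<open>n\<close> confine \<open>x\<close> to a set of small diameter, since \<open>f\<close> does not
  decrease distances along a branch. Any finite measurable label is nearly constant on sets of small
  diameter (\<open>cond_ent_small_mesh\<close>). So following any other label as well costs almost nothing per step, and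
  no partition has entropy above \<open>branch_entropy\<close> (\<open>KS_entropy_eq_branch_entropy\<close>).

  \<^bold>\<open>Patterns.\<close> List the branches of the \<open>n\<close> sample points by increasing height. This word determines the
  pattern: points on different branches are ordered from left to right like the branches, points on the
  same branch like their heights or in reverse (\<open>pattern_determined\<close>). Conversely, the pattern and the
  number of points on each branch determine the word, and these numbers carry only entropy of order
  \<open>ln n\<close>. Given the heights, the letters of the word are independent and each has entropy
  \<open>branch_entropy\<close> on average. The bounds \<open>pattern_entropy_le\<close> and \<open>pattern_entropy_ge\<close> make this
  precise with heights known up to a grid: a fixed grid for the upper bound, and one with
  \<open>n\<^sup>3\<close> cells, which separates the heights with high probability, for the lower bound.
\<close>

section \<open>Entropy of finite-valued random variables\<close>

definition level_prob :: "'a measure \<Rightarrow> ('a \<Rightarrow> 'b) \<Rightarrow> 'b \<Rightarrow> real" where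
  "level_prob M X v = measure M {\<omega> \<in> space M. X \<omega> = v}"

text \<open>A random variable may take its values in any type: its entropy is the expectation of the
  information of its level sets, so it depends only on the partition into level sets. Finiteness of
  the range and measurability are carried by \<^const>\<open>simple_function\<close>. The integral form makes an
  entropy inequality follow from a pointwise comparison of probabilities, and values of probability
  zero drop out because they are taken on a null set only.\<close>

definition ent :: "'a measure \<Rightarrow> ('a \<Rightarrow> 'b) \<Rightarrow> real" where
  "ent M X = (\<integral>\<omega>. - ln (level_prob M X (X \<omega>)) \<partial>M)"

definition cond_ent :: "'a measure \<Rightarrow> ('a \<Rightarrow> 'b) \<Rightarrow> ('a \<Rightarrow> 'c) \<Rightarrow> real" where
  "cond_ent M X Z = ent M (\<lambda>\<omega>. (X \<omega>, Z \<omega>)) - ent M Z"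

lemma simple_function_comp_left:
  "simple_function M X \<Longrightarrow> simple_function M (\<lambda>\<omega>. g (X \<omega>))"
  by (drule simple_function_compose[of M X g]) (simp only: comp_def)

context prob_space
begin

lemma simple_level_set:
  "simple_function M X \<Longrightarrow> {\<omega> \<in> space M. P (X \<omega>)} \<in> sets M"
proof -
  assume X: "simple_function M X"
  have "{\<omega> \<in> space M. P (X \<omega>)} = X -` Collect P \<inter> space M" by blast
  then show ?thesis using simple_functionD(2)[OF X, of "Collect P"] by (simp only:)
qed

lemma integrable_simple:
  "simple_function M (X :: 'a \<Rightarrow> real) \<Longrightarrow> integrable M X"
  by (rule integrable_simple_function) (auto simp: emeasure_eq_measure)

lemma integrable_of_simple:
  "simple_function M X \<Longrightarrow> integrable M (\<lambda>\<omega>. g (X \<omega>) :: real)"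
  by (rule integrable_simple, rule simple_function_comp_left)

lemma expectation_of_simple:
  assumes "simple_function M X" "finite I" "X ` space M \<subseteq> I"
  shows "(\<integral>\<omega>. g (X \<omega>) \<partial>M) = (\<Sum>v\<in>I. g v * level_prob M X v)"
proof -
  have m: "{\<omega> \<in> space M. X \<omega> = v} \<in> sets M" for v
    by (rule simple_level_set[OF assms(1)])
  have "(\<integral>\<omega>. g (X \<omega>) \<partial>M) = (\<integral>\<omega>. (\<Sum>v\<in>I. g v * indicator {\<omega> \<in> space M. X \<omega> = v} \<omega>) \<partial>M)"
  proof (rule Bochner_Integration.integral_cong[OF refl])
    fix \<omega> assume w: "\<omega> \<in> space M"
    then have "(\<Sum>v\<in>I. g v * indicator {\<omega> \<in> space M. X \<omega> = v} \<omega>) = (\<Sum>v\<in>I. if X \<omega> = v then g v else 0)"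
      by (intro sum.cong) auto
    also have "\<dots> = g (X \<omega>)" using assms(2,3) w by auto
    finally show "g (X \<omega>) = (\<Sum>v\<in>I. g v * indicator {\<omega> \<in> space M. X \<omega> = v} \<omega>)" ..
  qed
  also have "\<dots> = (\<Sum>v\<in>I. (\<integral>\<omega>. g v * indicator {\<omega> \<in> space M. X \<omega> = v} \<omega> \<partial>M))"
    using m by (intro Bochner_Integration.integral_sum integrable_mult_right)
      (auto simp: emeasure_eq_measure)
  also have "\<dots> = (\<Sum>v\<in>I. g v * level_prob M X v)"
    by (simp add: level_prob_def Int_absorb2 subset_eq)
  finally show ?thesis .
qed

lemma sum_level_prob:
  assumes "simple_function M X" "finite I" "X ` space M \<subseteq> I"
  shows "(\<Sum>v\<in>I. level_prob M X v) = 1"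
  using expectation_of_simple[OF assms, of "\<lambda>_. 1"] by (simp add: prob_space)

lemma level_prob_nonneg [simp]: "0 \<le> level_prob M X v"
  and level_prob_le_1 [simp]: "level_prob M X v \<le> 1"
  by (simp_all add: level_prob_def)

lemma AE_level_prob_pos:
  assumes "simple_function M X"
  shows "AE \<omega> in M. 0 < level_prob M X (X \<omega>)"
proof -
  let ?I = "{v \<in> X ` space M. level_prob M X v = 0}"
  have "finite ?I" using simple_functionD(1)[OF assms] by simp
  moreover have "AE \<omega> in M. X \<omega> \<noteq> v" if "v \<in> ?I" for v
    using that simple_level_set[OF assms, of "\<lambda>x. x = v"]
    by (intro AE_I[of _ _ "{\<omega> \<in> space M. X \<omega> = v}"]) (auto simp: level_prob_def emeasure_eq_measure)
  ultimately have "AE \<omega> in M. \<forall>v\<in>?I. X \<omega> \<noteq> v" by (intro AE_finite_allI)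
  then show ?thesis
  proof (rule AE_mp, intro AE_I2 impI)
    fix \<omega> assume "\<omega> \<in> space M" "\<forall>v\<in>?I. X \<omega> \<noteq> v"
    then have "level_prob M X (X \<omega>) \<noteq> 0" by auto
    then show "0 < level_prob M X (X \<omega>)" using level_prob_nonneg[of X "X \<omega>"] by linarith
  qed
qed

lemma ent_eq_sum:
  assumes "simple_function M X" "finite I" "X ` space M \<subseteq> I"
  shows "ent M X = shannon_entropy (level_prob M X) I"
proof -
  have "ent M X = (\<Sum>v\<in>I. - ln (level_prob M X v) * level_prob M X v)"
    unfolding ent_def by (rule expectation_of_simple[OF assms])
  also have "\<dots> = shannon_entropy (level_prob M X) I"
    unfolding shannon_entropy_def sum_negf[symmetric] by (intro sum.cong refl) (rule minus_mult_left[symmetric, THEN trans], rule arg_cong[of _ _ uminus], rule mult.commute)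
  finally show ?thesis .
qed

lemma integrable_ln_level_prob:
  "simple_function M X \<Longrightarrow> integrable M (\<lambda>\<omega>. - ln (level_prob M X (X \<omega>)))"
  by (rule integrable_of_simple)

lemma ln_level_prob_nonpos: "ln (level_prob M X v) \<le> 0"
proof -
  have "level_prob M X v = 0 \<or> 0 < level_prob M X v"
    using level_prob_nonneg[of X v] by linarith
  then show ?thesis
    by (elim disjE) (simp_all only: ln_0 ln_le_zero_iff order_refl level_prob_le_1)
qed

lemma ent_nonneg: "0 \<le> ent M X"
  unfolding ent_def by (rule integral_nonneg_AE) (simp add: ln_level_prob_nonpos)

text \<open>Gibbs' inequality for a guess \<open>q x z\<close> of the conditional probabilities: the difference of the two
  sides is an expectation of \<open>ln (q(x|z) p(z) / p(x,z))\<close>, and \<open>ln t \<le> t - 1\<close> turns it into a sum of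
  total mass at most \<open>1\<close> minus \<open>1\<close>. Every upper bound on a conditional entropy below comes from a
  choice of \<open>q\<close>.\<close>

lemma cond_ent_le_cross:
  assumes X: "simple_function M X" and Z: "simple_function M Z"
    and nn: "\<And>x z. 0 \<le> q x z"
    and q: "\<And>z. z \<in> Z ` space M \<Longrightarrow> (\<Sum>x\<in>X ` space M. q x z) \<le> 1"
    and pos: "AE \<omega> in M. 0 < q (X \<omega>) (Z \<omega>)"
  shows "cond_ent M X Z \<le> (\<integral>\<omega>. - ln (q (X \<omega>) (Z \<omega>)) \<partial>M)"
proof -
  let ?W = "\<lambda>\<omega>. (X \<omega>, Z \<omega>)"
  let ?p = "level_prob M ?W" and ?r = "level_prob M Z"
  have W: "simple_function M ?W" by (rule simple_function_Pair[OF X Z])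
  have fin: "finite (X ` space M)" "finite (Z ` space M)"
    using X Z by (auto dest: simple_functionD)
  have i: "integrable M (\<lambda>\<omega>. g (X \<omega>) (Z \<omega>) :: real)" for g
    using integrable_of_simple[OF W, of "\<lambda>(x, z). g x z"] by simp
  have "cond_ent M X Z - (\<integral>\<omega>. - ln (q (X \<omega>) (Z \<omega>)) \<partial>M) =
      (\<integral>\<omega>. - ln (?p (?W \<omega>)) - - ln (?r (Z \<omega>)) - - ln (q (X \<omega>) (Z \<omega>)) \<partial>M)"
    unfolding cond_ent_def ent_def
    by (simp only: Bochner_Integration.integral_diff[OF integrable_ln_level_prob[OF W] integrable_ln_level_prob[OF Z]]
      Bochner_Integration.integral_diff[OF i[of "\<lambda>x z. - ln (?p (x, z)) - - ln (?r z)"] i[of "\<lambda>x z. - ln (q x z)"]])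
  also have "\<dots> \<le> (\<integral>\<omega>. q (X \<omega>) (Z \<omega>) * ?r (Z \<omega>) / ?p (?W \<omega>) - 1 \<partial>M)"
  proof (rule integral_mono_AE)
    show "AE \<omega> in M. - ln (?p (?W \<omega>)) - - ln (?r (Z \<omega>)) - - ln (q (X \<omega>) (Z \<omega>))
        \<le> q (X \<omega>) (Z \<omega>) * ?r (Z \<omega>) / ?p (?W \<omega>) - 1"
      using AE_level_prob_pos[OF W] AE_level_prob_pos[OF Z] pos
    proof eventually_elim
      case (elim \<omega>)
      then have "- ln (?p (?W \<omega>)) - - ln (?r (Z \<omega>)) - - ln (q (X \<omega>) (Z \<omega>))
          = ln (q (X \<omega>) (Z \<omega>) * ?r (Z \<omega>) / ?p (?W \<omega>))"
        by (simp add: ln_div ln_mult)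
      also have "\<dots> \<le> q (X \<omega>) (Z \<omega>) * ?r (Z \<omega>) / ?p (?W \<omega>) - 1"
        using elim by (intro ln_le_minus_one) simp
      finally show ?case .
    qed
    show "integrable M (\<lambda>\<omega>. - ln (?p (?W \<omega>)) - - ln (?r (Z \<omega>)) - - ln (q (X \<omega>) (Z \<omega>)))"
      using i[of "\<lambda>x z. - ln (?p (x, z)) - - ln (?r z) - - ln (q x z)"] .
    show "integrable M (\<lambda>\<omega>. q (X \<omega>) (Z \<omega>) * ?r (Z \<omega>) / ?p (?W \<omega>) - 1)"
      using i[of "\<lambda>x z. q x z * ?r z / ?p (x, z) - 1"] .
  qed
  also have "\<dots> = (\<integral>\<omega>. (\<lambda>(x, z). q x z * ?r z / ?p (x, z)) (?W \<omega>) \<partial>M) - 1"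
    using i[of "\<lambda>x z. q x z * ?r z / ?p (x, z)"] by (simp add: prob_space)
  also have "(\<integral>\<omega>. (\<lambda>(x, z). q x z * ?r z / ?p (x, z)) (?W \<omega>) \<partial>M) =
      (\<Sum>w\<in>X ` space M \<times> Z ` space M. (\<lambda>(x, z). q x z * ?r z / ?p (x, z)) w * ?p w)"
    using fin by (intro expectation_of_simple[OF W]) auto
  also have "\<dots> \<le> (\<Sum>w\<in>X ` space M \<times> Z ` space M. (\<lambda>(x, z). q x z * ?r z) w)"
  proof (intro sum_mono, clarify)
    fix x z
    show "q x z * ?r z / ?p (x, z) * ?p (x, z) \<le> q x z * ?r z"
      by (cases "?p (x, z) = 0") (use nn in simp_all)
  qed
  also have "\<dots> = (\<Sum>z\<in>Z ` space M. (\<Sum>x\<in>X ` space M. q x z) * ?r z)"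
    by (subst sum.cartesian_product[symmetric], subst sum.swap) (simp add: sum_distrib_right)
  also have "\<dots> \<le> (\<Sum>z\<in>Z ` space M. 1 * ?r z)"
    by (intro sum_mono mult_right_mono q) auto
  also have "\<dots> = 1" using sum_level_prob[OF Z fin(2)] by simp
  finally show ?thesis by simp
qed

text \<open>If \<open>Z\<close> determines \<open>X\<close> up to a null set, then the level sets of \<open>Z\<close> are the smaller ones.\<close>

lemma ent_mono_AE:
  assumes X: "simple_function M X" and Z: "simple_function M Z"
    and G: "AE \<omega> in M. G \<omega>"
    and det: "\<And>\<omega> \<omega>'. \<omega> \<in> space M \<Longrightarrow> \<omega>' \<in> space M \<Longrightarrow> G \<omega> \<Longrightarrow> G \<omega>' \<Longrightarrow> Z \<omega> = Z \<omega>' \<Longrightarrow> X \<omega> = X \<omega>'"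
  shows "ent M X \<le> ent M Z"
  unfolding ent_def
proof (rule integral_mono_AE[OF integrable_ln_level_prob[OF X] integrable_ln_level_prob[OF Z]])
  show "AE \<omega> in M. - ln (level_prob M X (X \<omega>)) \<le> - ln (level_prob M Z (Z \<omega>))"
    using AE_level_prob_pos[OF X] AE_level_prob_pos[OF Z] G AE_space
  proof eventually_elim
    case (elim \<omega>)
    have "level_prob M Z (Z \<omega>) \<le> level_prob M X (X \<omega>)"
      unfolding level_prob_def
    proof (rule finite_measure_mono_AE)
      show "AE x in M. x \<in> {\<omega>' \<in> space M. Z \<omega>' = Z \<omega>} \<longrightarrow> x \<in> {\<omega>' \<in> space M. X \<omega>' = X \<omega>}"
        using G by eventually_elim (use elim det in blast)
    qed (rule simple_level_set[OF X])
    then show ?case using elim by simp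
  qed
qed

lemma ent_mono:
  assumes "simple_function M X" "simple_function M Z"
    and "\<And>\<omega> \<omega>'. \<omega> \<in> space M \<Longrightarrow> \<omega>' \<in> space M \<Longrightarrow> Z \<omega> = Z \<omega>' \<Longrightarrow> X \<omega> = X \<omega>'"
  shows "ent M X \<le> ent M Z"
  by (rule ent_mono_AE[OF assms(1,2), of "\<lambda>_. True"]) (use assms(3) in blast)+

lemma ent_cong_level:
  assumes "\<And>\<omega> \<omega>'. \<omega> \<in> space M \<Longrightarrow> \<omega>' \<in> space M \<Longrightarrow> X \<omega> = X \<omega>' \<longleftrightarrow> Z \<omega> = Z \<omega>'"
  shows "ent M X = ent M Z"
  unfolding ent_def
proof (intro Bochner_Integration.integral_cong refl)
  fix \<omega> assume "\<omega> \<in> space M"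
  then have "{\<omega>' \<in> space M. X \<omega>' = X \<omega>} = {\<omega>' \<in> space M. Z \<omega>' = Z \<omega>}" using assms by blast
  then show "- ln (level_prob M X (X \<omega>)) = - ln (level_prob M Z (Z \<omega>))" 
    by (simp add: level_prob_def)
qed

lemma cond_ent_nonneg:
  "simple_function M X \<Longrightarrow> simple_function M Z \<Longrightarrow> 0 \<le> cond_ent M X Z"
  using ent_mono[of Z "\<lambda>\<omega>. (X \<omega>, Z \<omega>)"] by (simp add: cond_ent_def)

text \<open>Strong subadditivity, in the form that a finer condition leaves less entropy. It is Gibbs' inequality
  with the conditional probabilities given the coarser variable \<open>Z\<close> as the guess.\<close>

lemma cond_ent_antimono:
  assumes X: "simple_function M X" and Z: "simple_function M Z" and Y: "simple_function M Y"
    and det: "\<And>\<omega> \<omega>'. \<omega> \<in> space M \<Longrightarrow> \<omega>' \<in> space M \<Longrightarrow> Y \<omega> = Y \<omega>' \<Longrightarrow> Z \<omega> = Z \<omega>'"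
  shows "cond_ent M X Y \<le> cond_ent M X Z"
proof -
  let ?W = "\<lambda>\<omega>. (X \<omega>, Z \<omega>)"
  have W: "simple_function M ?W" by (rule simple_function_Pair[OF X Z])
  define g where "g y = Z (SOME \<omega>. \<omega> \<in> space M \<and> Y \<omega> = y)" for y
  have g: "g (Y \<omega>) = Z \<omega>" if "\<omega> \<in> space M" for \<omega>
    unfolding g_def by (rule someI2[of _ \<omega>]) (use that det in blast)+
  define q where "q x y = level_prob M ?W (x, g y) / level_prob M Z (g y)" for x y
  have "cond_ent M X Y \<le> (\<integral>\<omega>. - ln (q (X \<omega>) (Y \<omega>)) \<partial>M)"
  proof (rule cond_ent_le_cross[OF X Y])
    show "0 \<le> q x y" for x y by (simp add: q_def)
    show "AE \<omega> in M. 0 < q (X \<omega>) (Y \<omega>)"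
      using AE_level_prob_pos[OF W] AE_level_prob_pos[OF Z] AE_space
      by eventually_elim (simp add: q_def g)
    show "(\<Sum>x\<in>X ` space M. q x y) \<le> 1" for y
    proof -
      have fin: "finite (X ` space M)" using X by (auto dest: simple_functionD)
      have "level_prob M Z z = (\<Sum>x\<in>X ` space M. level_prob M ?W (x, z))" for z
      proof -
        have ms: "{\<omega> \<in> space M. X \<omega> = x \<and> Z \<omega> = z} \<in> sets M" for x
          using simple_level_set[OF W, of "\<lambda>w. w = (x, z)"] by simp
        have "{\<omega> \<in> space M. Z \<omega> = z} = (\<Union>x\<in>X ` space M. {\<omega> \<in> space M. ?W \<omega> = (x, z)})" by auto
        then have "level_prob M Z z = measure M (\<Union>x\<in>X ` space M. {\<omega> \<in> space M. ?W \<omega> = (x, z)})"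
          by (simp only: level_prob_def)
        also have "\<dots> = (\<Sum>x\<in>X ` space M. measure M {\<omega> \<in> space M. ?W \<omega> = (x, z)})"
          using fin by (intro finite_measure_finite_Union)
            (auto simp: disjoint_family_on_def ms)
        finally show ?thesis by (simp add: level_prob_def)
      qed
      then show ?thesis by (simp add: q_def flip: sum_divide_distrib)
    qed
  qed
  also have "\<dots> = (\<integral>\<omega>. - ln (level_prob M ?W (?W \<omega>)) - - ln (level_prob M Z (Z \<omega>)) \<partial>M)"
  proof (rule integral_cong_AE)
    show "AE \<omega> in M. - ln (q (X \<omega>) (Y \<omega>)) = - ln (level_prob M ?W (?W \<omega>)) - - ln (level_prob M Z (Z \<omega>))"
      using AE_level_prob_pos[OF W] AE_level_prob_pos[OF Z] AE_space
      by eventually_elim (simp add: q_def g ln_div)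
    show "(\<lambda>\<omega>. - ln (q (X \<omega>) (Y \<omega>))) \<in> borel_measurable M"
      using integrable_of_simple[OF simple_function_Pair[OF X Y], of "\<lambda>(x, y). - ln (q x y)"] by auto
    show "(\<lambda>\<omega>. - ln (level_prob M ?W (?W \<omega>)) - - ln (level_prob M Z (Z \<omega>))) \<in> borel_measurable M"
      using integrable_ln_level_prob[OF W] integrable_ln_level_prob[OF Z] by auto
  qed
  also have "\<dots> = cond_ent M X Z"
    unfolding cond_ent_def ent_def
    by (rule Bochner_Integration.integral_diff[OF integrable_ln_level_prob[OF W] integrable_ln_level_prob[OF Z]])
  finally show ?thesis .
qed

lemma ent_const: "ent M (\<lambda>_. c) = 0"
  by (simp add: ent_def level_prob_def prob_space)

lemma cond_ent_const: "cond_ent M X (\<lambda>_. c) = ent M X"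
  using ent_cong_level[of "\<lambda>\<omega>. (X \<omega>, c)" X] by (simp add: cond_ent_def ent_const)

lemma cond_ent_le_ent:
  "simple_function M X \<Longrightarrow> simple_function M Z \<Longrightarrow> cond_ent M X Z \<le> ent M X"
  using cond_ent_antimono[of X "\<lambda>_. ()" Z] by (simp add: cond_ent_const)

lemma ent_pair_le:
  "simple_function M X \<Longrightarrow> simple_function M Z \<Longrightarrow> ent M (\<lambda>\<omega>. (X \<omega>, Z \<omega>)) \<le> ent M X + ent M Z"
  using cond_ent_le_ent[of X Z] by (simp add: cond_ent_def)

lemma cond_ent_triangle:
  assumes X: "simple_function M X" and Y: "simple_function M Y" and Z: "simple_function M Z"
  shows "cond_ent M X Z \<le> cond_ent M X Y + cond_ent M Y Z"
proof -
  have "ent M (\<lambda>\<omega>. (X \<omega>, Z \<omega>)) \<le> ent M (\<lambda>\<omega>. (X \<omega>, (Y \<omega>, Z \<omega>)))"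
    using X Y Z by (intro ent_mono) auto
  moreover have "cond_ent M X (\<lambda>\<omega>. (Y \<omega>, Z \<omega>)) \<le> cond_ent M X Y"
    using X Y Z by (intro cond_ent_antimono) auto
  ultimately show ?thesis by (simp add: cond_ent_def)
qed

lemma ent_le_ln_card:
  assumes X: "simple_function M X" and R: "finite R" "X ` space M \<subseteq> R"
  shows "ent M X \<le> ln (card R)"
proof -
  have ne: "R \<noteq> {}" using R(2) not_empty by auto
  then have c: "0 < card R" using R(1) by (simp add: card_gt_0_iff)
  have "cond_ent M X (\<lambda>_. ()) \<le> (\<integral>\<omega>. - ln (1 / real (card R)) \<partial>M)"
    using X c card_mono[OF R] by (intro cond_ent_le_cross) (auto simp: field_simps)
  also have "\<dots> = ln (card R)" using c by (simp add: prob_space ln_div)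
  finally show ?thesis by (simp add: cond_ent_const)
qed

text \<open>Fano's inequality with a free parameter \<open>e\<close>: the guess puts mass \<open>1 - e\<close> on the value predicted by
  \<open>Z\<close> and spreads \<open>e\<close> evenly over the range. The freedom to send \<open>e\<close> and \<open>prob E\<close> to \<open>0\<close> one after
  the other makes the bound arbitrarily small.\<close>

lemma cond_ent_fano:
  assumes X: "simple_function M X" and Z: "simple_function M Z"
    and R: "finite R" "X ` space M \<subseteq> R"
    and E: "E \<in> sets M" and e: "0 < e" "e < 1"
    and det: "\<And>\<omega> \<omega>'. \<omega> \<in> space M - E \<Longrightarrow> \<omega>' \<in> space M - E \<Longrightarrow> Z \<omega> = Z \<omega>' \<Longrightarrow> X \<omega> = X \<omega>'"
  shows "cond_ent M X Z \<le> - ln (1 - e) + prob E * ln (card R / e)"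
proof -
  define g where "g z = X (SOME \<omega>. \<omega> \<in> space M - E \<and> Z \<omega> = z)" for z
  have g: "g (Z \<omega>) = X \<omega>" if "\<omega> \<in> space M - E" for \<omega>
    unfolding g_def by (rule someI2[of _ \<omega>]) (use that det in blast)+
  have ne: "R \<noteq> {}" using R(2) not_empty by auto
  then have c: "0 < card R" using R(1) by (simp add: card_gt_0_iff)
  define q where "q x z = (1 - e) * of_bool (x = g z) + e / card R" for x z
  have qpos: "0 < q x z" for x z using c e by (auto simp: q_def add_nonneg_pos)
  have q1: "q x z \<ge> e / card R" for x z using e by (auto simp: q_def)
  have q2: "q x z \<ge> 1 - e" if "x = g z" for x z using e that by (auto simp: q_def)
  have le: "e / card R < 1" using c e by (auto simp: field_simps)
  have "cond_ent M X Z \<le> (\<integral>\<omega>. - ln (q (X \<omega>) (Z \<omega>)) \<partial>M)"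
  proof (rule cond_ent_le_cross[OF X Z])
    show "(\<Sum>x\<in>X ` space M. q x z) \<le> 1" for z
    proof -
      have "(\<Sum>x\<in>X ` space M. q x z) \<le> (\<Sum>x\<in>R. q x z)"
        using R qpos by (intro sum_mono2) (auto intro: less_imp_le)
      also have "\<dots> = (1 - e) * (\<Sum>x\<in>R. of_bool (x = g z)) + e"
        using c by (simp add: q_def sum.distrib flip: sum_distrib_left)
      also have "(\<Sum>x\<in>R. of_bool (x = g z)) \<le> (1 :: real)"
        using R(1) by (simp add: of_bool_def)
      then have "(1 - e) * (\<Sum>x\<in>R. of_bool (x = g z)) + e \<le> (1 - e) * 1 + e"
        using e by (intro add_right_mono mult_left_mono) auto
      finally show ?thesis by simp
    qed
  qed (auto simp: qpos less_imp_le)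
  also have "\<dots> \<le> (\<integral>\<omega>. - ln (1 - e) + ln (card R / e) * indicator E \<omega> \<partial>M)"
  proof (rule integral_mono_AE)
    show "integrable M (\<lambda>\<omega>. - ln (q (X \<omega>) (Z \<omega>)))"
      using integrable_of_simple[OF simple_function_Pair[OF X Z], of "\<lambda>(x, y). - ln (q x y)"] by auto
    show "integrable M (\<lambda>\<omega>. - ln (1 - e) + ln (card R / e) * indicator E \<omega>)"
      using E by (auto simp: emeasure_eq_measure)
    show "AE \<omega> in M. - ln (q (X \<omega>) (Z \<omega>)) \<le> - ln (1 - e) + ln (card R / e) * indicator E \<omega>"
    proof (intro AE_I2)
      fix \<omega> assume w: "\<omega> \<in> space M"
      show "- ln (q (X \<omega>) (Z \<omega>)) \<le> - ln (1 - e) + ln (card R / e) * indicator E \<omega>"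
      proof (cases "\<omega> \<in> E")
        case True
        have "ln (e / card R) \<le> ln (q (X \<omega>) (Z \<omega>))" using q1 c e qpos by (subst ln_le_cancel_iff) auto
        moreover have "ln (e / card R) = - ln (card R / e)" using c e by (simp add: ln_div)
        moreover have "ln (1 - e) \<le> 0" using e by simp
        ultimately show ?thesis using True by simp
      next
        case False
        have "ln (1 - e) \<le> ln (q (X \<omega>) (Z \<omega>))" using q2[of "X \<omega>" "Z \<omega>"] g[of \<omega>] w False e qpos
          by (subst ln_le_cancel_iff) auto
        then show ?thesis using False by simp
      qed
    qed
  qed
  also have "\<dots> = - ln (1 - e) + prob E * ln (card R / e)"
    using E by (subst Bochner_Integration.integral_add) (auto simp: emeasure_eq_measure prob_space)
  finally show ?thesis .
qed

end

lemma ent_distr: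
  assumes "g \<in> M \<rightarrow>\<^sub>M N" "prob_space N" "simple_function N X"
  shows "ent (distr M N g) X = ent M (\<lambda>\<omega>. X (g \<omega>))"
proof -
  interpret N: prob_space N by fact
  have "level_prob (distr M N g) X v = level_prob M (\<lambda>\<omega>. X (g \<omega>)) v" for v
    unfolding level_prob_def using measurable_space[OF assms(1)] N.simple_level_set[OF assms(3), of "\<lambda>x. x = v"]
    by (subst measure_distr[OF assms(1)]) (auto intro!: arg_cong[of _ _ "measure M"])
  moreover have "(\<lambda>\<omega>. - ln (level_prob M (\<lambda>\<omega>. X (g \<omega>)) (X \<omega>))) \<in> borel_measurable N"
    using N.integrable_of_simple[OF assms(3)] by (intro borel_measurable_integrable)
  ultimately show ?thesis
    unfolding ent_def by (simp add: integral_distr[OF assms(1)])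
qed

section \<open>Partitions and itineraries\<close>

definition fibres :: "'a measure \<Rightarrow> ('a \<Rightarrow> 'b) \<Rightarrow> 'a set set" where
  "fibres M X = (\<lambda>\<omega>. {\<omega>' \<in> space M. X \<omega>' = X \<omega>}) ` space M"

lemma (in prob_space) shannon_entropy_fibres:
  assumes X: "simple_function M X"
  shows "shannon_entropy (measure M) (fibres M X) = ent M X"
proof -
  let ?C = "\<lambda>\<omega>. {\<omega>' \<in> space M. X \<omega>' = X \<omega>}"
  have C: "simple_function M ?C"
    using simple_function_comp_left[OF X, of "\<lambda>v. {\<omega>' \<in> space M. X \<omega>' = v}"] .
  have fin: "finite (fibres M X)"
    unfolding fibres_def by (rule simple_functionD(1)[OF C])
  have C_eq: "X \<omega> = X \<omega>' \<longleftrightarrow> ?C \<omega> = ?C \<omega>'" if "\<omega> \<in> space M" for \<omega> \<omega>'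
  proof
    assume "?C \<omega> = ?C \<omega>'"
    moreover have "\<omega> \<in> ?C \<omega>" using that by simp
    ultimately have "\<omega> \<in> ?C \<omega>'" by (rule subst)
    then show "X \<omega> = X \<omega>'" by simp
  qed simp
  have "ent M X = ent M ?C" by (rule ent_cong_level) (rule C_eq)
  also have "\<dots> = shannon_entropy (level_prob M ?C) (fibres M X)"
    by (rule ent_eq_sum[OF C fin]) (simp add: fibres_def)
  also have "\<dots> = shannon_entropy (measure M) (fibres M X)"
  proof -
    have "level_prob M ?C A = measure M A" if A: "A \<in> fibres M X" for A
    proof -
      obtain w where w: "w \<in> space M" "A = ?C w" using A unfolding fibres_def by blast
      have "{\<omega> \<in> space M. ?C \<omega> = A} = A"
        unfolding w(2) by (intro Collect_cong conj_cong refl) (rule C_eq[symmetric])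
      then show ?thesis by (simp only: level_prob_def)
    qed
    then show ?thesis by (simp add: shannon_entropy_def)
  qed
  finally show ?thesis ..
qed

lemma (in prob_space) fibres_in_finite_partitions:
  assumes X: "simple_function M X"
  shows "fibres M X \<in> finite_partitions M"
proof -
  have "finite (fibres M X)"
    unfolding fibres_def
    using simple_functionD(1)[OF simple_function_comp_left[OF X, of "\<lambda>v. {\<omega>' \<in> space M. X \<omega>' = v}"]] .
  moreover have "fibres M X \<subseteq> sets M"
    unfolding fibres_def by (intro image_subsetI simple_level_set[OF X])
  moreover have "partition_on (space M) (fibres M X)"
    by (auto simp: partition_on_def disjoint_def fibres_def)
  ultimately show ?thesis by (simp add: finite_partitions_def)
qed

lemma finite_partition_label:
  fixes M :: "'a measure"
  assumes Q: "Q \<in> finite_partitions M"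
  obtains R :: "'a \<Rightarrow> 'a set" where "simple_function M R" "fibres M R = Q"
proof -
  have fin: "finite Q" and sets: "Q \<subseteq> sets M" and part: "partition_on (space M) Q"
    using Q by (auto simp: finite_partitions_def)
  define R where "R \<omega> = (THE A. A \<in> Q \<and> \<omega> \<in> A)" for \<omega>
  have R: "R \<omega> = A" if "A \<in> Q" "\<omega> \<in> A" for A \<omega>
    unfolding R_def using that part by (intro the_equality) (auto simp: partition_on_def disjoint_def)
  have ex: "\<exists>A\<in>Q. \<omega> \<in> A" if "\<omega> \<in> space M" for \<omega>
    using that part by (auto simp: partition_on_def)
  have level: "{\<omega>' \<in> space M. R \<omega>' = A} = A" if A: "A \<in> Q" for A
    using A R ex sets.sets_into_space[of A M] sets by blast
  have img: "R ` space M = Q"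
  proof
    show "R ` space M \<subseteq> Q" using R ex by blast
    show "Q \<subseteq> R ` space M"
    proof
      fix A assume A: "A \<in> Q"
      then have "A \<noteq> {}" using part by (auto simp: partition_on_def)
      then obtain \<omega> where "\<omega> \<in> A" by blast
      then show "A \<in> R ` space M" using R[OF A] A sets sets.sets_into_space[of A M] by blast
    qed
  qed
  have "R -` {A} \<inter> space M \<in> sets M" if "A \<in> R ` space M" for A
  proof -
    have "R -` {A} \<inter> space M = A" using level[of A] that img by blast
    then show ?thesis using that img sets by auto
  qed
  then have "simple_function M R"
    using fin img by (simp add: simple_function_def)
  moreover have "fibres M R = Q"
  proof -
    have "fibres M R = (\<lambda>A. {\<omega>' \<in> space M. R \<omega>' = A}) ` (R ` space M)"
      by (auto simp: fibres_def)
    also have "\<dots> = Q" using level img by auto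
    finally show ?thesis .
  qed
  ultimately show ?thesis by (rule that)
qed

text \<open>Labels replace partitions: the iterated join of the level sets of \<open>R\<close> consists of the level sets of
  the list of labels along an orbit, see \<open>iterated_join_fibres\<close>. Lists make the first step of the
  orbit, which is where invariance of the measure enters, a constructor.\<close>

definition itinerary :: "('a \<Rightarrow> 'a) \<Rightarrow> ('a \<Rightarrow> 'b) \<Rightarrow> nat \<Rightarrow> 'a \<Rightarrow> 'b list" where
  "itinerary T R n x = map (\<lambda>k. R ((T ^^ k) x)) [0..<n]"

lemma itinerary_eq_iff:
  "itinerary T R n x = itinerary T R n y \<longleftrightarrow> (\<forall>k<n. R ((T ^^ k) x) = R ((T ^^ k) y))"
  by (auto simp: itinerary_def)

lemma itinerary_Suc: "itinerary T R (Suc n) x = R x # itinerary T R n (T x)"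
  unfolding itinerary_def by (simp add: upt_conv_Cons map_Suc_upt[symmetric] funpow_swap1 del: upt_Suc)

lemma funpow_in_space:
  "T \<in> M \<rightarrow>\<^sub>M M \<Longrightarrow> x \<in> space M \<Longrightarrow> (T ^^ k) x \<in> space M"
  by (induction k) (auto dest: measurable_space)

lemma iterated_join_fibres:
  assumes T: "T \<in> M \<rightarrow>\<^sub>M M"
  shows "iterated_join M T (fibres M R) n = fibres M (itinerary T R n)"
proof -
  let ?F = "\<lambda>x. {y \<in> space M. R y = R x}"
  have join: "space M \<inter> (\<Inter>k<n. (T ^^ k) -` ?F ((T ^^ k) x)) =
      {y \<in> space M. itinerary T R n y = itinerary T R n x}" for x
    using funpow_in_space[OF T] by (auto simp: itinerary_eq_iff)
  show ?thesis
  proof (intro equalityI subsetI)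
    fix A assume "A \<in> iterated_join M T (fibres M R) n"
    then obtain c where c: "\<forall>k<n. c k \<in> fibres M R" and A: "A = space M \<inter> (\<Inter>k<n. (T ^^ k) -` c k)"
      and "A \<noteq> {}" by (auto simp: iterated_join_def)
    then obtain x where x: "x \<in> A" by blast
    have "c k = ?F ((T ^^ k) x)" if "k < n" for k
    proof -
      have "(T ^^ k) x \<in> c k" using x A that by blast
      moreover have "c k \<in> fibres M R" using c that by blast
      then obtain y where "c k = ?F y" unfolding fibres_def by blast
      ultimately show ?thesis by auto
    qed
    then have "A = space M \<inter> (\<Inter>k<n. (T ^^ k) -` ?F ((T ^^ k) x))" using A by auto
    moreover have "x \<in> space M" using x A by blast
    ultimately show "A \<in> fibres M (itinerary T R n)"
      unfolding fibres_def join by blast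
  next
    fix A assume "A \<in> fibres M (itinerary T R n)"
    then obtain x where x: "x \<in> space M" and A: "A = space M \<inter> (\<Inter>k<n. (T ^^ k) -` ?F ((T ^^ k) x))"
      unfolding fibres_def join by blast
    have "x \<in> A" using x funpow_in_space[OF T x] by (auto simp: A)
    moreover have "\<forall>k<n. ?F ((T ^^ k) x) \<in> fibres M R"
      using funpow_in_space[OF T x] by (auto simp: fibres_def)
    ultimately show "A \<in> iterated_join M T (fibres M R) n"
      unfolding iterated_join_def
      by (intro DiffI CollectI exI[of _ "\<lambda>k. ?F ((T ^^ k) x)"] conjI A) auto
  qed
qed

locale mp_system = prob_space +
  fixes T
  assumes mp: "measure_preserving M T"
begin

lemma T_measurable: "T \<in> M \<rightarrow>\<^sub>M M" and T_distr: "distr M M T = M"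
  using mp by (auto simp: measure_preserving_def)

lemma simple_function_shift: "simple_function M X \<Longrightarrow> simple_function M (\<lambda>x. X (T x))"
  by (rule simple_function_comp[OF T_measurable])

lemma simple_function_funpow: "simple_function M X \<Longrightarrow> simple_function M (\<lambda>x. X ((T ^^ k) x))"
proof (induction k arbitrary: X)
  case (Suc k)
  show ?case using Suc.IH[OF simple_function_shift[OF Suc.prems]] by simp
qed simp

lemma ent_shift: "simple_function M X \<Longrightarrow> ent M (\<lambda>x. X (T x)) = ent M X"
  using ent_distr[OF T_measurable prob_space_axioms, of X] by (simp add: T_distr)

lemma cond_ent_shift:
  "simple_function M X \<Longrightarrow> simple_function M Z \<Longrightarrow>
    cond_ent M (\<lambda>x. X (T x)) (\<lambda>x. Z (T x)) = cond_ent M X Z"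
  using ent_shift[of "\<lambda>x. (X x, Z x)"] ent_shift[of Z] by (simp add: cond_ent_def)

lemma simple_function_itinerary:
  assumes "simple_function M R"
  shows "simple_function M (itinerary T R n)"
proof (induction n)
  case 0
  show ?case by (simp add: itinerary_def[abs_def])
next
  case (Suc n)
  have "simple_function M (\<lambda>x. (\<lambda>(a, l). a # l) (R x, itinerary T R n (T x)))"
    by (rule simple_function_comp_left, rule simple_function_Pair[OF assms simple_function_shift[OF Suc]])
  then show ?case by (simp add: itinerary_Suc[abs_def])
qed

lemma ent_itinerary_Suc:
  assumes "simple_function M R"
  shows "ent M (itinerary T R (Suc n)) =
    ent M (itinerary T R n) + cond_ent M R (\<lambda>x. itinerary T R n (T x))"
proof -
  have "ent M (itinerary T R (Suc n)) = ent M (\<lambda>x. (R x, itinerary T R n (T x)))"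
    by (rule ent_cong_level) (simp add: itinerary_Suc)
  then show ?thesis
    using ent_shift[OF simple_function_itinerary[OF assms, of n]] by (simp add: cond_ent_def)
qed

text \<open>The increments of the itinerary entropy are entropies of the present given a growing future, hence
  decreasing. So the entropy is a concave function of \<open>n\<close> that starts at \<open>0\<close>, and its quotient by
  \<open>n\<close> decreases. Without convergence, the limit in \<^const>\<open>entropy_wrt_partition\<close> would be an
  unspecified number.\<close>

lemma entropy_rate_converges:
  assumes R: "simple_function M R"
  shows "convergent (\<lambda>n. ent M (itinerary T R n) / real n)"
proof -
  let ?a = "\<lambda>n. ent M (itinerary T R n)"
  define d where "d n = cond_ent M R (\<lambda>x. itinerary T R n (T x))" for n
  have a0: "?a 0 = 0" using ent_const[of "[]"] by (simp add: itinerary_def[abs_def])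
  have aS: "?a (Suc n) = ?a n + d n" for n
    unfolding d_def by (rule ent_itinerary_Suc[OF R])
  have dS: "d (Suc n) \<le> d n" for n
    unfolding d_def
    by (intro cond_ent_antimono simple_function_shift simple_function_itinerary R)
      (auto simp: itinerary_eq_iff)
  have "real n * d n \<le> ?a n" for n
  proof (induction n)
    case (Suc n)
    have "real (Suc n) * d (Suc n) \<le> real (Suc n) * d n"
      by (intro mult_left_mono dS) auto
    then show ?case using Suc aS[of n] by (simp add: algebra_simps)
  qed (simp add: a0)
  then have le: "?a (Suc n) * real n \<le> ?a n * real (Suc n)" for n
    using aS[of n] by (simp add: algebra_simps)
  have "decseq (\<lambda>n. ?a (Suc n) / real (Suc n))"
  proof (rule decseq_SucI)
    fix n show "?a (Suc (Suc n)) / real (Suc (Suc n)) \<le> ?a (Suc n) / real (Suc n)"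
      using le[of "Suc n"] by (simp add: divide_simps mult.commute)
  qed
  then have "convergent (\<lambda>n. ?a (Suc n) / real (Suc n))"
    by (rule decseq_convergent[of _ 0]) (auto simp: ent_nonneg convergent_def)
  then show ?thesis
    by (subst (asm) convergent_Suc_iff)
qed

lemma entropy_wrt_fibres:
  assumes R: "simple_function M R"
  shows "(\<lambda>n. ent M (itinerary T R n) / real n) \<longlonglongrightarrow> entropy_wrt_partition M T (fibres M R)"
proof -
  have "shannon_entropy (measure M) (iterated_join M T (fibres M R) n) = ent M (itinerary T R n)" for n
    unfolding iterated_join_fibres[OF T_measurable]
    by (rule shannon_entropy_fibres[OF simple_function_itinerary[OF R]])
  then show ?thesis
    using entropy_rate_converges[OF R] by (simp add: entropy_wrt_partition_def convergent_LIMSEQ_iff)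
qed

end

section \<open>Fine partitions of the unit interval\<close>

interpretation unit: prob_space unit_lborel
  by (rule prob_space_unit_lborel)

definition grid :: "nat \<Rightarrow> real \<Rightarrow> nat" where
  "grid m x = nat \<lfloor>real m * x\<rfloor>"

lemma simple_function_mono_label:
  fixes g :: "real \<Rightarrow> nat"
  assumes g: "mono_on {0..1} g"
  shows "simple_function unit_lborel g"
proof -
  have "g ` {0..1} \<subseteq> {..g 1}" using g by (auto simp: mono_on_def)
  then have "finite (g ` {0..1})" by (rule finite_subset) simp
  moreover have "g -` {v} \<inter> {0..1} \<in> sets unit_lborel" for v
  proof -
    have "is_interval (g -` {v} \<inter> {0..1})"
      unfolding is_interval_1
    proof (intro ballI allI impI)
      fix a b x assume ab: "a \<in> g -` {v} \<inter> {0..1}" "b \<in> g -` {v} \<inter> {0..1}" "a \<le> x \<and> x \<le> b"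
      then have "g a \<le> g x" "g x \<le> g b"
        using mono_onD[OF g, of a x] mono_onD[OF g, of x b] by auto
      then show "x \<in> g -` {v} \<inter> {0..1}" using ab by auto
    qed
    then have "g -` {v} \<inter> {0..1} \<in> sets borel" by (rule real_interval_borel_measurable)
    then show ?thesis by (simp add: sets_restrict_space_iff)
  qed
  ultimately show ?thesis by (simp add: simple_function_def space_unit_lborel)
qed

lemma mono_grid: "mono_on {0..1} (grid m)"
  unfolding grid_def by (intro mono_onI nat_mono floor_mono mult_left_mono) auto

lemma simple_function_grid: "simple_function unit_lborel (grid m)"
  by (rule simple_function_mono_label[OF mono_grid])

lemma grid_le: "x \<in> {0..1} \<Longrightarrow> grid m x \<le> m"
  using mono_onD[OF mono_grid, of x 1 m] by (auto simp: grid_def)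

lemma grid_eq_dist:
  assumes "m > 0" "x \<in> {0..1}" "y \<in> {0..1}" "grid m x = grid m y"
  shows "\<bar>x - y\<bar> \<le> 1 / real m"
proof -
  have "\<lfloor>real m * x\<rfloor> = \<lfloor>real m * y\<rfloor>"
    using assms by (simp add: grid_def nat_eq_iff2)
  then have "\<bar>real m * x - real m * y\<bar> \<le> 1" by linarith
  then have "real m * \<bar>x - y\<bar> \<le> 1"
    by (simp add: abs_mult flip: right_diff_distrib)
  then show ?thesis using assms by (simp add: field_simps)
qed

lemma inner_compact:
  assumes "A \<in> sets unit_lborel" "0 < e"
  obtains K where "compact K" "K \<subseteq> A" "K \<in> sets unit_lborel" "measure unit_lborel (A - K) \<le> e"
proof -
  have A: "A \<in> sets borel" "A \<subseteq> {0..1}" using assms(1) by (auto simp: sets_restrict_space_iff)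
  then have "A \<in> sets lebesgue" by simp
  then obtain K where K: "closed K" "K \<subseteq> A" "A - K \<in> lmeasurable" "emeasure lebesgue (A - K) < ennreal e"
    using sets_lebesgue_inner_closed[OF _ assms(2)] by metis
  have Kc: "compact K"
    using K A by (meson bounded_closed_interval bounded_subset compact_eq_bounded_closed order_trans)
  have Ks: "K \<in> sets unit_lborel" using K A by (auto simp: sets_restrict_space_iff)
  have eq: "emeasure unit_lborel (A - K) = emeasure lebesgue (A - K)"
    using A K by (subst emeasure_restrict_space) auto
  have "ennreal (measure unit_lborel (A - K)) < ennreal e"
    unfolding unit.emeasure_eq_measure[symmetric] eq by (rule K(4))
  then have "measure unit_lborel (A - K) \<le> e"
    using assms(2) by (simp add: ennreal_less_iff)
  then show ?thesis using that Kc K(2) Ks by blast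
qed

text \<open>Each level set of \<open>R\<close> is exhausted up to small measure by a compact set, and finitely many disjoint
  compact sets have positive distance from each other.\<close>

lemma nearly_locally_constant:
  assumes R: "simple_function unit_lborel R" and e: "0 < e"
  obtains d E where "0 < d" "E \<in> sets unit_lborel" "measure unit_lborel E \<le> e"
    "\<And>x y. x \<in> {0..1} - E \<Longrightarrow> y \<in> {0..1} - E \<Longrightarrow> \<bar>x - y\<bar> \<le> d \<Longrightarrow> R x = R y"
proof -
  let ?V = "R ` {0..1}" and ?A = "\<lambda>v. {x \<in> {0..1}. R x = v}"
  have fin: "finite ?V" using simple_functionD(1)[OF R] by (simp add: space_unit_lborel)
  have c: "0 < card ?V" using fin by (auto simp: card_gt_0_iff)
  have A: "?A v \<in> sets unit_lborel" for v
    using unit.simple_level_set[OF R, of "\<lambda>x. x = v"] by (simp add: space_unit_lborel)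
  have "\<exists>K. compact K \<and> K \<subseteq> ?A v \<and> K \<in> sets unit_lborel \<and> measure unit_lborel (?A v - K) \<le> e / card ?V" for v
    by (rule inner_compact[OF A[of v], of "e / card ?V"]) (use e c in auto)
  then obtain K where K': "\<And>v. compact (K v) \<and> K v \<subseteq> ?A v \<and> K v \<in> sets unit_lborel \<and>
    measure unit_lborel (?A v - K v) \<le> e / card ?V" by meson
  then have K: "\<And>v. compact (K v)" "\<And>v. K v \<subseteq> ?A v" "\<And>v. K v \<in> sets unit_lborel"
    "\<And>v. measure unit_lborel (?A v - K v) \<le> e / card ?V" by blast+
  have "\<exists>d>0. \<forall>x\<in>K v. \<forall>y\<in>K w. d \<le> dist x y" if "v \<noteq> w" for v w
  proof -
    have "K v \<inter> K w = {}" using K(2)[of v] K(2)[of w] that by auto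
    then show ?thesis
      using separate_compact_closed[OF K(1) compact_imp_closed[OF K(1)]] by blast
  qed
  then have "\<forall>p. \<exists>d. fst p \<noteq> snd p \<longrightarrow> 0 < d \<and> (\<forall>x\<in>K (fst p). \<forall>y\<in>K (snd p). d \<le> dist x y)"
    by blast
  from choice[OF this] obtain d where d': "\<And>p. fst p \<noteq> snd p \<Longrightarrow>
      0 < d p \<and> (\<forall>x\<in>K (fst p). \<forall>y\<in>K (snd p). d p \<le> dist x y)"
    by blast
  have d: "\<And>v w. v \<noteq> w \<Longrightarrow> 0 < d (v, w)"
    "\<And>v w x y. v \<noteq> w \<Longrightarrow> x \<in> K v \<Longrightarrow> y \<in> K w \<Longrightarrow> d (v, w) \<le> dist x y"
    using d'[of "(_, _)"] by auto
  define d0 where "d0 = Min (insert 1 (d ` {(v, w). v \<in> ?V \<and> w \<in> ?V \<and> v \<noteq> w}))"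
  have fin2: "finite {(v, w). v \<in> ?V \<and> w \<in> ?V \<and> v \<noteq> w}"
    by (rule finite_subset[OF _ finite_cartesian_product[OF fin fin]]) auto
  have d0: "0 < d0" unfolding d0_def using fin2 d(1) by (subst Min_gr_iff) auto
  have d0_le: "d0 \<le> d (v, w)" if "v \<in> ?V" "w \<in> ?V" "v \<noteq> w" for v w
    unfolding d0_def using fin2 that by (intro Min_le) (auto intro!: image_eqI[of _ _ "(v, w)"])
  define E where "E = (\<Union>v\<in>?V. ?A v - K v)"
  have "measure unit_lborel E \<le> (\<Sum>v\<in>?V. measure unit_lborel (?A v - K v))"
    unfolding E_def using A K(3) by (intro unit.finite_measure_subadditive_finite fin) auto
  also have "\<dots> \<le> (\<Sum>v\<in>?V. e / card ?V)" by (intro sum_mono K(4))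
  also have "\<dots> = e" using c by simp
  finally have Ee: "measure unit_lborel E \<le> e" .
  have Es: "E \<in> sets unit_lborel" unfolding E_def using A K(3) fin by (intro sets.finite_UN sets.Diff) auto
  have inK: "x \<in> K (R x)" if "x \<in> {0..1} - E" for x using that by (auto simp: E_def)
  show ?thesis
  proof (rule that[of "d0 / 2" E])
    fix x y assume xy: "x \<in> {0..1} - E" "y \<in> {0..1} - E" "\<bar>x - y\<bar> \<le> d0 / 2"
    show "R x = R y"
    proof (rule ccontr)
      assume ne: "R x \<noteq> R y"
      have "d0 \<le> d (R x, R y)" using xy ne by (intro d0_le) auto
      also have "\<dots> \<le> dist x y" using inK xy by (intro d(2) ne)
      finally show False using xy d0 by (simp add: dist_real_def)
    qed
  qed (use d0 Es Ee in auto)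
qed

text \<open>Every label is almost determined by any sufficiently fine partition, of whatever shape: outside a
  small exceptional set, points of a set of small diameter carry the same label, so Fano's inequality
  applies. This takes the place of generators and of the martingale convergence theorem.\<close>

lemma cond_ent_small_mesh:
  fixes R :: "real \<Rightarrow> 'r"
  assumes R: "simple_function unit_lborel R" and e: "0 < e"
  obtains d where "0 < d" "\<And>Z :: real \<Rightarrow> 'z. simple_function unit_lborel Z \<Longrightarrow>
    (\<And>x y. x \<in> {0..1} \<Longrightarrow> y \<in> {0..1} \<Longrightarrow> Z x = Z y \<Longrightarrow> \<bar>x - y\<bar> \<le> d) \<Longrightarrow> cond_ent unit_lborel R Z \<le> e"
proof -
  let ?V = "R ` {0..1}"
  \<comment> \<open>This choice makes the first term of Fano's bound equal to \<open>e / 2\<close>.\<close>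
  define h where "h = 1 - exp (- e / 2)"
  have h: "0 < h" "h < 1" "- ln (1 - h) = e / 2" using e by (auto simp: h_def)
  have fin: "finite ?V" using simple_functionD(1)[OF R] by (simp add: space_unit_lborel)
  have c: "0 < card ?V" using fin by (auto simp: card_gt_0_iff)
  have "h < card ?V" using h(2) c by linarith
  then have l: "0 < ln (card ?V / h)" using h by (intro ln_gt_zero) (simp add: field_simps)
  obtain d E where d: "0 < d" "E \<in> sets unit_lborel" "measure unit_lborel E \<le> e / 2 / ln (card ?V / h)"
    "\<And>x y. x \<in> {0..1} - E \<Longrightarrow> y \<in> {0..1} - E \<Longrightarrow> \<bar>x - y\<bar> \<le> d \<Longrightarrow> R x = R y"
    using nearly_locally_constant[OF R, of "e / 2 / ln (card ?V / h)"] e l by (auto intro: divide_pos_pos)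
  show ?thesis
  proof (rule that[OF d(1)])
    fix Z :: "real \<Rightarrow> 'z"
    assume Z: "simple_function unit_lborel Z"
      and mesh: "\<And>x y. x \<in> {0..1} \<Longrightarrow> y \<in> {0..1} \<Longrightarrow> Z x = Z y \<Longrightarrow> \<bar>x - y\<bar> \<le> d"
    have "cond_ent unit_lborel R Z \<le> - ln (1 - h) + measure unit_lborel E * ln (card ?V / h)"
    proof (rule unit.cond_ent_fano[OF R Z fin _ d(2) h(1,2)])
      show "R ` space unit_lborel \<subseteq> ?V" by (simp add: space_unit_lborel)
      fix x y assume "x \<in> space unit_lborel - E" "y \<in> space unit_lborel - E" "Z x = Z y"
      then show "R x = R y" using d(4)[of x y] mesh[of x y] by (simp add: space_unit_lborel)
    qed
    also have "\<dots> \<le> e / 2 + (e / 2 / ln (card ?V / h)) * ln (card ?V / h)"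
      unfolding h(3) using d(3) l by (intro add_left_mono mult_right_mono) auto
    also have "\<dots> = e" using l by simp
    finally show "cond_ent unit_lborel R Z \<le> e" .
  qed
qed

section \<open>Entropy of a piecewise monotone expanding map\<close>

text \<open>The number \<open>X x\<close> tells on which piece of monotonicity \<open>x\<close> lies; pieces are numbered from left to
  right, so that monotonicity of \<open>X\<close> makes them intervals.\<close>

locale branched_map =
  fixes f :: "real \<Rightarrow> real" and X :: "real \<Rightarrow> nat"
  assumes measure_preserving: "measure_preserving unit_lborel f"
    and mono_X: "mono_on {0..1} X"
    and expanding: "\<And>x y. x \<in> {0..1} \<Longrightarrow> y \<in> {0..1} \<Longrightarrow> X x = X y \<Longrightarrow> \<bar>x - y\<bar> \<le> \<bar>f x - f y\<bar>"
    and strict: "\<And>a. monotone_on {x \<in> {0..1}. X x = a} (<) (<) f \<or>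
      monotone_on {x \<in> {0..1}. X x = a} (<) (>) f"
begin

sublocale dyn: mp_system unit_lborel f
  by unfold_locales (rule measure_preserving)

lemma simple_X: "simple_function unit_lborel X"
  by (rule simple_function_mono_label[OF mono_X])

text \<open>The entropy of the branch through \<open>x\<close> given the value \<open>f x\<close>, with the exact value approximated by its
  position in a grid. For smooth branches it is the integral of \<open>ln \<bar>f'\<bar>\<close>, as the branch through
  \<open>x\<close> has conditional probability \<open>1 / \<bar>f' x\<bar>\<close>.\<close>

definition branch_entropy :: real where
  "branch_entropy = (INF m\<in>{1..}. cond_ent unit_lborel X (\<lambda>x. grid m (f x)))"

lemma bdd_below_branch_entropy:
  "bdd_below ((\<lambda>m. cond_ent unit_lborel X (\<lambda>x. grid m (f x))) ` {1..})"
  by (rule bdd_belowI2[of _ 0])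
    (intro unit.cond_ent_nonneg simple_X dyn.simple_function_shift simple_function_grid)

text \<open>A fine grid nearly determines \<open>Z\<close>, so knowing the grid cell of \<open>f x\<close> is nearly as good as
  knowing \<open>Z (f x)\<close>.\<close>

lemma branch_entropy_le:
  fixes Z :: "real \<Rightarrow> 'z"
  assumes Z: "simple_function unit_lborel Z"
  shows "branch_entropy \<le> cond_ent unit_lborel X (\<lambda>x. Z (f x))"
proof (rule field_le_epsilon)
  fix e :: real assume e: "0 < e"
  obtain d where d: "0 < d" "\<And>Y :: real \<Rightarrow> nat. simple_function unit_lborel Y \<Longrightarrow>
      (\<And>x y. x \<in> {0..1} \<Longrightarrow> y \<in> {0..1} \<Longrightarrow> Y x = Y y \<Longrightarrow> \<bar>x - y\<bar> \<le> d) \<Longrightarrow>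
      cond_ent unit_lborel Z Y \<le> e"
    using cond_ent_small_mesh[OF Z e] by metis
  obtain m :: nat where m: "m > 0" "1 / real m < d"
    using d(1) by (metis nat_approx_posE zero_less_Suc)
  have "cond_ent unit_lborel Z (grid m) \<le> e"
  proof (rule d(2)[OF simple_function_grid])
    fix x y :: real assume "x \<in> {0..1}" "y \<in> {0..1}" "grid m x = grid m y"
    then show "\<bar>x - y\<bar> \<le> d" using grid_eq_dist[OF m(1)] m(2) by fastforce
  qed
  then have "cond_ent unit_lborel (\<lambda>x. Z (f x)) (\<lambda>x. grid m (f x)) \<le> e"
    by (simp add: dyn.cond_ent_shift[OF Z simple_function_grid])
  moreover have "branch_entropy \<le> cond_ent unit_lborel X (\<lambda>x. grid m (f x))"
    unfolding branch_entropy_def using m by (intro cINF_lower bdd_below_branch_entropy) auto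
  moreover have "cond_ent unit_lborel X (\<lambda>x. grid m (f x)) \<le>
      cond_ent unit_lborel X (\<lambda>x. Z (f x)) + cond_ent unit_lborel (\<lambda>x. Z (f x)) (\<lambda>x. grid m (f x))"
    by (intro unit.cond_ent_triangle simple_X dyn.simple_function_shift simple_function_grid Z)
  ultimately show "branch_entropy \<le> cond_ent unit_lborel X (\<lambda>x. Z (f x)) + e" by linarith
qed

lemma cond_ent_near_branch_entropy:
  assumes "0 < e"
  obtains m where "m > 0" "cond_ent unit_lborel X (\<lambda>x. grid m (f x)) < branch_entropy + e"
proof -
  have "branch_entropy < branch_entropy + e" using assms by simp
  then obtain m where "m \<in> {1..}" "cond_ent unit_lborel X (\<lambda>x. grid m (f x)) < branch_entropy + e"
    using cINF_less_iff[OF _ bdd_below_branch_entropy, of "branch_entropy + e"]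
    unfolding branch_entropy_def[symmetric] by auto
  then show ?thesis by (intro that[of m]) auto
qed

lemma cond_ent_image_small_mesh:
  assumes e: "0 < e"
  obtains d where "0 < d" "\<And>Z :: real \<Rightarrow> 'z. simple_function unit_lborel Z \<Longrightarrow>
    (\<And>x y. x \<in> {0..1} \<Longrightarrow> y \<in> {0..1} \<Longrightarrow> Z x = Z y \<Longrightarrow> \<bar>x - y\<bar> \<le> d) \<Longrightarrow>
    cond_ent unit_lborel X (\<lambda>x. Z (f x)) \<le> branch_entropy + e"
proof -
  have e2: "0 < e / 2" using e by simp
  obtain m where m: "m > 0" "cond_ent unit_lborel X (\<lambda>x. grid m (f x)) < branch_entropy + e / 2"
    by (rule cond_ent_near_branch_entropy[OF e2])
  obtain d where d: "0 < d" "\<And>Z :: real \<Rightarrow> 'z. simple_function unit_lborel Z \<Longrightarrow>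
      (\<And>x y. x \<in> {0..1} \<Longrightarrow> y \<in> {0..1} \<Longrightarrow> Z x = Z y \<Longrightarrow> \<bar>x - y\<bar> \<le> d) \<Longrightarrow>
      cond_ent unit_lborel (grid m) Z \<le> e / 2"
    using cond_ent_small_mesh[OF simple_function_grid[of m] e2] by metis
  show ?thesis
  proof (rule that[OF d(1)])
    fix Z :: "real \<Rightarrow> 'z" assume Z: "simple_function unit_lborel Z"
      and mesh: "\<And>x y. x \<in> {0..1} \<Longrightarrow> y \<in> {0..1} \<Longrightarrow> Z x = Z y \<Longrightarrow> \<bar>x - y\<bar> \<le> d"
    have "cond_ent unit_lborel X (\<lambda>x. Z (f x)) \<le>
        cond_ent unit_lborel X (\<lambda>x. grid m (f x)) + cond_ent unit_lborel (\<lambda>x. grid m (f x)) (\<lambda>x. Z (f x))"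
      by (intro unit.cond_ent_triangle simple_X dyn.simple_function_shift simple_function_grid Z)
    also have "cond_ent unit_lborel (\<lambda>x. grid m (f x)) (\<lambda>x. Z (f x)) \<le> e / 2"
      unfolding dyn.cond_ent_shift[OF simple_function_grid Z] by (rule d(2)[OF Z mesh])
    finally show "cond_ent unit_lborel X (\<lambda>x. Z (f x)) \<le> branch_entropy + e"
      using m(2) by linarith
  qed
qed

lemma funpow_in: "x \<in> {0..1} \<Longrightarrow> (f ^^ k) x \<in> {0..1}"
  using funpow_in_space[OF dyn.T_measurable, of x k] by (simp add: space_unit_lborel)

text \<open>Two orbits that visit the same pieces move apart monotonically, so a common position at time \<open>n\<close> up to
  \<open>1 / m\<close> forces the starting points to be that close.\<close>

lemma itinerary_expanding:
  assumes "x \<in> {0..1}" "y \<in> {0..1}" "itinerary f X n x = itinerary f X n y"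
  shows "\<bar>x - y\<bar> \<le> \<bar>(f ^^ n) x - (f ^^ n) y\<bar>"
  using assms
proof (induction n)
  case (Suc n)
  have "\<bar>x - y\<bar> \<le> \<bar>(f ^^ n) x - (f ^^ n) y\<bar>"
    using Suc by (intro Suc.IH) (auto simp: itinerary_eq_iff)
  also have "\<dots> \<le> \<bar>f ((f ^^ n) x) - f ((f ^^ n) y)\<bar>"
    using Suc.prems by (intro expanding funpow_in) (auto simp: itinerary_eq_iff)
  finally show ?case by simp
qed simp

lemma ent_itinerary_X_ge: "real n * branch_entropy \<le> ent unit_lborel (itinerary f X n)"
proof (induction n)
  case (Suc n)
  have "branch_entropy \<le> cond_ent unit_lborel X (\<lambda>x. itinerary f X n (f x))"
    by (rule branch_entropy_le[OF dyn.simple_function_itinerary[OF simple_X]])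
  then show ?case
    using Suc dyn.ent_itinerary_Suc[OF simple_X, of n] by (simp add: algebra_simps)
qed (simp add: unit.ent_nonneg)

text \<open>Beside the itinerary of \<open>R\<close>, follow \<open>W n\<close>: the itinerary of \<open>X\<close> and the grid position at time
  \<open>n\<close>. Expansion makes the level sets of \<open>W n\<close> small, uniformly in \<open>n\<close>. Prepending one step to the
  orbit then costs little more than the branch entropy for the new value of \<open>X\<close>, and after that
  almost nothing for the new value of \<open>R\<close>, which the small level sets nearly determine.\<close>

lemma ent_itinerary_le:
  fixes R :: "real \<Rightarrow> 'r"
  assumes R: "simple_function unit_lborel R" and e: "0 < e"
  shows "\<exists>C. \<forall>n. ent unit_lborel (itinerary f R n) \<le> C + real n * (branch_entropy + e)"
proof -
  have e2: "0 < e / 2" using e by simp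
  obtain d1 where d1: "0 < d1" "\<And>Z :: real \<Rightarrow> nat list \<times> nat. simple_function unit_lborel Z \<Longrightarrow>
      (\<And>x y. x \<in> {0..1} \<Longrightarrow> y \<in> {0..1} \<Longrightarrow> Z x = Z y \<Longrightarrow> \<bar>x - y\<bar> \<le> d1) \<Longrightarrow>
      cond_ent unit_lborel R Z \<le> e / 2"
    using cond_ent_small_mesh[OF R e2] by metis
  obtain d2 where d2: "0 < d2" "\<And>Z :: real \<Rightarrow> nat list \<times> nat. simple_function unit_lborel Z \<Longrightarrow>
      (\<And>x y. x \<in> {0..1} \<Longrightarrow> y \<in> {0..1} \<Longrightarrow> Z x = Z y \<Longrightarrow> \<bar>x - y\<bar> \<le> d2) \<Longrightarrow>
      cond_ent unit_lborel X (\<lambda>x. Z (f x)) \<le> branch_entropy + e / 2"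
    using cond_ent_image_small_mesh[OF e2] by metis
  obtain m :: nat where m: "m > 0" "1 / real m < min d1 d2"
    using d1(1) d2(1) by (metis nat_approx_posE zero_less_Suc min_less_iff_conj)
  define W where "W n x = (itinerary f X n x, grid m ((f ^^ n) x))" for n x
  have W: "simple_function unit_lborel (W n)" for n
    unfolding W_def
    by (intro simple_function_Pair dyn.simple_function_itinerary dyn.simple_function_funpow
        simple_X simple_function_grid)
  have mesh: "\<bar>x - y\<bar> \<le> 1 / real m" if "x \<in> {0..1}" "y \<in> {0..1}" "W n x = W n y" for x y n
  proof -
    have "\<bar>x - y\<bar> \<le> \<bar>(f ^^ n) x - (f ^^ n) y\<bar>"
      using that by (intro itinerary_expanding) (auto simp: W_def)
    also have "\<dots> \<le> 1 / real m"
      using that by (intro grid_eq_dist[OF m(1)] funpow_in) (auto simp: W_def)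
    finally show ?thesis .
  qed
  have RW: "cond_ent unit_lborel R (W n) \<le> e / 2" for n
    by (rule d1(2)[OF W]) (use mesh m(2) in fastforce)
  have XW: "cond_ent unit_lborel X (\<lambda>x. W n (f x)) \<le> branch_entropy + e / 2" for n
    by (rule d2(2)[OF W]) (use mesh m(2) in fastforce)
  define V where "V n x = (itinerary f R n x, W n x)" for n x
  have V: "simple_function unit_lborel (V n)" for n
    unfolding V_def by (intro simple_function_Pair dyn.simple_function_itinerary R W)
  have step: "ent unit_lborel (V (Suc n)) \<le> ent unit_lborel (V n) + (branch_entropy + e)" for n
  proof -
    let ?Vf = "\<lambda>x. V n (f x)" and ?XV = "\<lambda>x. (X x, V n (f x))"
    have Vf: "simple_function unit_lborel ?Vf" by (rule dyn.simple_function_shift[OF V])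
    have XV: "simple_function unit_lborel ?XV" by (rule simple_function_Pair[OF simple_X Vf])
    \<comment> \<open>The pair of the value of \<open>X\<close> now and \<open>W n\<close> one step later amounts to \<open>W (Suc n)\<close>.\<close>
    have "ent unit_lborel (V (Suc n)) = ent unit_lborel (\<lambda>x. (R x, ?XV x))"
      by (rule unit.ent_cong_level) (auto simp: V_def W_def itinerary_Suc funpow_swap1)
    also have "\<dots> = cond_ent unit_lborel R ?XV + cond_ent unit_lborel X ?Vf + ent unit_lborel (V n)"
      using dyn.ent_shift[OF V] by (simp add: cond_ent_def)
    also have "cond_ent unit_lborel R ?XV \<le> cond_ent unit_lborel R (W (Suc n))"
      by (intro unit.cond_ent_antimono R W XV) (auto simp: V_def W_def itinerary_Suc funpow_swap1)
    also have "\<dots> \<le> e / 2" by (rule RW)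
    also have "cond_ent unit_lborel X ?Vf \<le> cond_ent unit_lborel X (\<lambda>x. W n (f x))"
      by (intro unit.cond_ent_antimono simple_X dyn.simple_function_shift W V) (auto simp: V_def)
    also have "\<dots> \<le> branch_entropy + e / 2" by (rule XW)
    finally show ?thesis by simp
  qed
  have V_le: "ent unit_lborel (V n) \<le> ent unit_lborel (V 0) + real n * (branch_entropy + e)" for n
  proof (induction n)
    case (Suc n)
    then show ?case using step[of n] by (simp add: algebra_simps)
  qed simp
  have "ent unit_lborel (itinerary f R n) \<le> ent unit_lborel (V n)" for n
    by (intro unit.ent_mono dyn.simple_function_itinerary R V) (auto simp: V_def)
  then show ?thesis using V_le order_trans by blast
qed

theorem KS_entropy_eq_branch_entropy: "KS_entropy unit_lborel f = ereal branch_entropy"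
proof (rule antisym)
  show "KS_entropy unit_lborel f \<le> ereal branch_entropy"
    unfolding KS_entropy_def
  proof (intro SUP_least)
    fix Q assume "Q \<in> finite_partitions unit_lborel"
    then obtain R :: "real \<Rightarrow> real set" where R: "simple_function unit_lborel R"
      and Q: "fibres unit_lborel R = Q" by (rule finite_partition_label)
    have lim: "(\<lambda>n. ent unit_lborel (itinerary f R n) / real n) \<longlonglongrightarrow> entropy_wrt_partition unit_lborel f Q"
      using dyn.entropy_wrt_fibres[OF R] by (simp add: Q)
    have "entropy_wrt_partition unit_lborel f Q \<le> branch_entropy"
    proof (rule field_le_epsilon)
      fix e :: real assume "0 < e"
      then obtain C where C: "\<And>n. ent unit_lborel (itinerary f R n) \<le> C + real n * (branch_entropy + e)"
        using ent_itinerary_le[OF R] by blast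
      have "(\<lambda>n. C / real n + (branch_entropy + e)) \<longlonglongrightarrow> 0 + (branch_entropy + e)"
        by (intro tendsto_add lim_const_over_n tendsto_const)
      moreover have "ent unit_lborel (itinerary f R n) / real n \<le> C / real n + (branch_entropy + e)"
        if "1 \<le> n" for n
        using C[of n] that by (simp add: field_simps)
      then have "\<exists>N. \<forall>n\<ge>N. ent unit_lborel (itinerary f R n) / real n \<le> C / real n + (branch_entropy + e)"
        by (intro exI[of _ 1]) simp
      ultimately have "entropy_wrt_partition unit_lborel f Q \<le> 0 + (branch_entropy + e)"
        by (rule LIMSEQ_le[OF lim])
      then show "entropy_wrt_partition unit_lborel f Q \<le> branch_entropy + e" by simp
    qed
    then show "ereal (entropy_wrt_partition unit_lborel f Q) \<le> ereal branch_entropy" by simp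
  qed
next
  let ?Q = "fibres unit_lborel X"
  have "branch_entropy \<le> entropy_wrt_partition unit_lborel f ?Q"
  proof (rule LIMSEQ_le_const[OF dyn.entropy_wrt_fibres[OF simple_X]], intro exI[of _ 1] allI impI)
    fix n :: nat assume "1 \<le> n"
    then show "branch_entropy \<le> ent unit_lborel (itinerary f X n) / real n"
      using ent_itinerary_X_ge[of n] by (simp add: field_simps)
  qed
  then show "ereal branch_entropy \<le> KS_entropy unit_lborel f"
    unfolding KS_entropy_def
    by (intro SUP_upper2[OF unit.fibres_in_finite_partitions[OF simple_X]]) simp
qed

end

section \<open>Independent samples\<close>

lemma simple_function_restrict:
  assumes "finite I" and Y: "\<And>i. i \<in> I \<Longrightarrow> simple_function M (Y i)"
  shows "simple_function M (\<lambda>\<omega>. restrict (\<lambda>i. Y i \<omega>) I)"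
  unfolding simple_function_def
proof (intro conjI ballI)
  let ?F = "\<lambda>\<omega>. restrict (\<lambda>i. Y i \<omega>) I"
  have "?F ` space M \<subseteq> (\<Pi>\<^sub>E i\<in>I. Y i ` space M)" by auto
  moreover have "finite (\<Pi>\<^sub>E i\<in>I. Y i ` space M)"
    using assms by (intro finite_PiE) (auto dest: simple_functionD)
  ultimately show "finite (?F ` space M)" by (rule finite_subset)
  fix v assume "v \<in> ?F ` space M"
  then have v: "v \<in> extensional I" by auto
  have "?F -` {v} \<inter> space M = {\<omega> \<in> space M. \<forall>i\<in>I. Y i \<omega> = v i}"
    using v by (auto simp: fun_eq_iff extensional_def)
  also have "\<dots> \<in> sets M"
  proof (rule sets.sets_Collect_finite_All[OF _ assms(1)])
    fix i assume "i \<in> I"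
    then have "Y i -` {v i} \<inter> space M \<in> sets M" using Y by (auto dest: simple_functionD)
    then show "{\<omega> \<in> space M. Y i \<omega> = v i} \<in> sets M" by (simp add: vimage_def Int_def conj_commute)
  qed
  finally show "?F -` {v} \<inter> space M \<in> sets M" .
qed

text \<open>The coordinates of the product space are independent with law \<open>N\<close>; additivity of entropy over them
  holds because the level sets of a vector of labels are boxes.\<close>

locale iid = prob_space N for N :: "'a measure" +
  fixes I :: "'i set"
  assumes finite_I: "finite I"
begin

abbreviation Om :: "('i \<Rightarrow> 'a) measure" where
  "Om \<equiv> Pi\<^sub>M I (\<lambda>_. N)"

lemma product_prob_space: "product_prob_space (\<lambda>_. N)"
  by unfold_locales

sublocale om: prob_space Om
  by (rule prob_space_PiM) (rule prob_space_axioms)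

lemma prob_all_in:
  assumes "J \<subseteq> I" "\<And>i. i \<in> J \<Longrightarrow> A i \<in> sets N"
  shows "measure Om {\<omega> \<in> space Om. \<forall>i\<in>J. \<omega> i \<in> A i} = (\<Prod>i\<in>J. measure N (A i))"
  using product_prob_space.emeasure_PiM_Collect[OF product_prob_space, of J I A] assms finite_subset[OF assms(1) finite_I]
  by (simp add: om.emeasure_eq_measure emeasure_eq_measure prod_ennreal prod_nonneg)

lemma AE_component: "i \<in> I \<Longrightarrow> AE x in N. P x \<Longrightarrow> AE \<omega> in Om. P (\<omega> i)"
  by (rule AE_PiM_component[of I "\<lambda>_. N"]) (rule prob_space_axioms)

lemma AE_all_components: "AE x in N. P x \<Longrightarrow> AE \<omega> in Om. \<forall>i\<in>I. P (\<omega> i)"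
  using finite_I by (intro AE_finite_allI AE_component)

lemma expectation_component:
  assumes "i \<in> I" "h \<in> borel_measurable N"
  shows "(\<integral>\<omega>. h (\<omega> i) \<partial>Om) = (\<integral>x. h x \<partial>N :: real)"
proof -
  have "(\<integral>x. h x \<partial>N) = (\<integral>x. h x \<partial>distr Om N (\<lambda>\<omega>. \<omega> i))"
    by (subst product_prob_space.PiM_component[OF product_prob_space assms(1)]) simp
  also have "\<dots> = (\<integral>\<omega>. h (\<omega> i) \<partial>Om)"
    using assms by (intro integral_distr measurable_component_singleton)
  finally show ?thesis ..
qed

lemma simple_component: "i \<in> I \<Longrightarrow> simple_function N g \<Longrightarrow> simple_function Om (\<lambda>\<omega>. g (\<omega> i))"
  by (rule simple_function_comp[OF measurable_component_singleton])

lemma simple_components: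
  "simple_function N g \<Longrightarrow> simple_function Om (\<lambda>\<omega>. restrict (\<lambda>i. g (\<omega> i)) I)"
  by (intro simple_function_restrict finite_I simple_component)

lemma ent_components:
  assumes g: "simple_function N g"
  shows "ent Om (\<lambda>\<omega>. restrict (\<lambda>i. g (\<omega> i)) I) = card I * ent N g"
proof -
  let ?F = "\<lambda>\<omega>. restrict (\<lambda>i. g (\<omega> i)) I"
  have lp: "level_prob Om ?F (?F \<omega>) = (\<Prod>i\<in>I. level_prob N g (g (\<omega> i)))" for \<omega>
  proof -
    have "{\<omega>' \<in> space Om. ?F \<omega>' = ?F \<omega>} = {\<omega>' \<in> space Om. \<forall>i\<in>I. \<omega>' i \<in> {x \<in> space N. g x = g (\<omega> i)}}"
      by (auto simp: space_PiM fun_eq_iff)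
    then show ?thesis
      using prob_all_in[of I "\<lambda>i. {x \<in> space N. g x = g (\<omega> i)}"] simple_level_set[OF g]
      by (simp add: level_prob_def)
  qed
  have meas: "(\<lambda>\<omega>. - ln (level_prob N g (g (\<omega> i)))) \<in> borel_measurable Om" if "i \<in> I" for i
    using om.integrable_of_simple[OF simple_component[OF that g], of "\<lambda>v. - ln (level_prob N g v)"] by auto
  have "ent Om ?F = (\<integral>\<omega>. (\<Sum>i\<in>I. - ln (level_prob N g (g (\<omega> i)))) \<partial>Om)"
    unfolding ent_def
  proof (rule integral_cong_AE)
    show "(\<lambda>\<omega>. - ln (level_prob Om ?F (?F \<omega>))) \<in> borel_measurable Om"
      using om.integrable_ln_level_prob[OF simple_components[OF g]] by auto
    show "(\<lambda>\<omega>. \<Sum>i\<in>I. - ln (level_prob N g (g (\<omega> i)))) \<in> borel_measurable Om"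
      by (rule borel_measurable_sum) (rule meas)
    show "AE \<omega> in Om. - ln (level_prob Om ?F (?F \<omega>)) = (\<Sum>i\<in>I. - ln (level_prob N g (g (\<omega> i))))"
      using AE_all_components[OF AE_level_prob_pos[OF g]]
    proof eventually_elim
      case (elim \<omega>)
      then have "ln (\<Prod>i\<in>I. level_prob N g (g (\<omega> i))) = (\<Sum>i\<in>I. ln (level_prob N g (g (\<omega> i))))"
        by (intro ln_prod) (auto simp: finite_I)
      then show ?case by (simp only: lp sum_negf)
    qed
  qed
  also have "\<dots> = (\<Sum>i\<in>I. (\<integral>\<omega>. - ln (level_prob N g (g (\<omega> i))) \<partial>Om))"
    by (rule Bochner_Integration.integral_sum)
      (rule om.integrable_of_simple[OF simple_component[OF _ g]])
  also have "\<dots> = (\<Sum>i\<in>I. ent N g)"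
    unfolding ent_def
    by (intro sum.cong refl expectation_component borel_measurable_integrable integrable_ln_level_prob g)
  finally show ?thesis by simp
qed

end

section \<open>Ranks\<close>

lemma rank_among_less_iff:
  assumes "k \<in> {1..n}" "l \<in> {1..n}"
  shows "rank_among n v k < rank_among n v l \<longleftrightarrow> v k < v l \<or> (v k = v l \<and> k < l)"
proof -
  have lt: "rank_among n v i < rank_among n v j"
    if "i \<in> {1..n}" "j \<in> {1..n}" "v i < v j \<or> (v i = v j \<and> i < j)" for i j
  proof -
    have "{k \<in> {1..n}. v k < v i \<or> (v k = v i \<and> k \<le> i)} \<subset> {k \<in> {1..n}. v k < v j \<or> (v k = v j \<and> k \<le> j)}"
      using that by force
    then have "card {k \<in> {1..n}. v k < v i \<or> (v k = v i \<and> k \<le> i)}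
        < card {k \<in> {1..n}. v k < v j \<or> (v k = v j \<and> k \<le> j)}"
      by (intro psubset_card_mono) auto
    then show ?thesis using that by (simp add: rank_among_def)
  qed
  consider "k = l" | "v k < v l \<or> (v k = v l \<and> k < l)" | "v l < v k \<or> (v l = v k \<and> l < k)"
    by fastforce
  then show ?thesis
    using lt[of k l] lt[of l k] assms by cases auto
qed

text \<open>For a label that is monotone in the value, the points with small labels are the points with small
  ranks, so the label of a point can be read off from its rank and the label counts. This recovers
  labels at logarithmic cost, once for heights and once for horizontal positions.\<close>

lemma label_le_iff_rank_le:
  fixes g :: "real \<Rightarrow> nat"
  assumes g: "mono_on S g" and v: "\<And>k. k \<in> {1..n} \<Longrightarrow> v k \<in> S" and l: "l \<in> {1..n}"
  shows "g (v l) \<le> j \<longleftrightarrow> rank_among n v l \<le> card {k \<in> {1..n}. g (v k) \<le> j}"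
proof -
  let ?S = "{k \<in> {1..n}. v k < v l \<or> (v k = v l \<and> k \<le> l)}"
  have r: "rank_among n v l = card ?S" using l by (simp add: rank_among_def)
  show ?thesis
  proof
    assume le: "g (v l) \<le> j"
    have "g (v k) \<le> j" if "k \<in> ?S" for k
      using mono_onD[OF g, of "v k" "v l"] v[of k] v[OF l] that le by auto
    then have "?S \<subseteq> {k \<in> {1..n}. g (v k) \<le> j}" by auto
    then show "rank_among n v l \<le> card {k \<in> {1..n}. g (v k) \<le> j}"
      unfolding r by (intro card_mono) auto
  next
    assume le: "rank_among n v l \<le> card {k \<in> {1..n}. g (v k) \<le> j}"
    show "g (v l) \<le> j"
    proof (rule ccontr)
      assume gt: "\<not> g (v l) \<le> j"
      have "v k < v l" if "k \<in> {1..n}" "g (v k) \<le> j" for k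
      proof (rule ccontr)
        assume "\<not> v k < v l"
        then have "g (v l) \<le> g (v k)" using v that l by (intro mono_onD[OF g]) auto
        then show False using gt that by simp
      qed
      then have "{k \<in> {1..n}. g (v k) \<le> j} \<subset> ?S" using l gt by auto
      then have "card {k \<in> {1..n}. g (v k) \<le> j} < card ?S" by (intro psubset_card_mono) auto
      then show False using le by (simp add: r)
    qed
  qed
qed

lemma inv_rank_in: "i \<in> {1..n} \<Longrightarrow> inv (rank_among n v) i \<in> {1..n}"
  using permutes_in_image[OF permutes_inv[OF rank_among_permutes[of n v]], of i] by simp

lemma rank_inv_rank: "rank_among n v (inv (rank_among n v) i) = i"
  by (rule permutes_inverses(1)[OF rank_among_permutes])

lemma card_sorted:
  "card {k \<in> {1..n}. P k} = card {j \<in> {1..n}. P (inv (rank_among n v) j)}"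
proof -
  let ?t = "inv (rank_among n v)"
  have "bij_betw ?t {j \<in> {1..n}. P (?t j)} {k \<in> {1..n}. P k}"
  proof (rule bij_betw_byWitness[where f' = "rank_among n v"])
    show "rank_among n v ` {k \<in> {1..n}. P k} \<subseteq> {j \<in> {1..n}. P (?t j)}"
      using permutes_in_image[OF rank_among_permutes[of n v]]
        permutes_inverses(2)[OF rank_among_permutes[of n v]] by auto
  qed (use rank_inv_rank permutes_inverses(2)[OF rank_among_permutes[of n v]] inv_rank_in in auto)
  then show ?thesis by (rule bij_betw_same_card[symmetric])
qed

section \<open>The pattern of a sample\<close>

locale sampled_map = branched_map +
  fixes \<mu> :: "(real \<times> real) measure" and n :: nat
  assumes induced: "induced_permuton f \<mu>"
begin

lemma permuton: "permuton \<mu>"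
  using induced by (simp add: induced_permuton_def)

lemma sets_mu: "sets \<mu> = sets (unit_lborel \<Otimes>\<^sub>M unit_lborel)"
  using permuton by (simp add: permuton_def sets_unit_square)

sublocale smp: iid \<mu> "{1..n}"
  using permuton by (simp add: iid_def iid_axioms_def permuton_def)

lemma space_mu: "space \<mu> = {0..1} \<times> {0..1}"
  using sets_eq_imp_space_eq[OF sets_mu] by (simp add: space_pair_measure space_unit_lborel)

lemma fst_measurable: "fst \<in> \<mu> \<rightarrow>\<^sub>M unit_lborel" and snd_measurable: "snd \<in> \<mu> \<rightarrow>\<^sub>M unit_lborel"
  by (subst measurable_cong_sets[OF sets_mu refl], measurable)+

lemma sample_in_space: "\<omega> \<in> space smp.Om \<Longrightarrow> i \<in> {1..n} \<Longrightarrow> \<omega> i \<in> space \<mu>"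
  by (auto simp: space_PiM)

lemma sample_in:
  assumes "\<omega> \<in> space smp.Om" "i \<in> {1..n}"
  shows "fst (\<omega> i) \<in> {0..1}" "snd (\<omega> i) \<in> {0..1}"
proof -
  have "\<omega> i \<in> space \<mu>" using assms by (rule sample_in_space)
  then show "fst (\<omega> i) \<in> {0..1}" "snd (\<omega> i) \<in> {0..1}" by (auto simp: space_mu)
qed

lemma graph_measurable: "(\<lambda>x. (x, f x)) \<in> unit_lborel \<rightarrow>\<^sub>M \<mu>"
proof -
  have "(\<lambda>x. (x, f x)) \<in> unit_lborel \<rightarrow>\<^sub>M unit_lborel \<Otimes>\<^sub>M unit_lborel"
    using dyn.T_measurable by measurable
  then show ?thesis using measurable_cong_sets[OF refl sets_mu] by blast
qed

lemma distr_graph: "distr unit_lborel \<mu> (\<lambda>x. (x, f x)) = \<mu>"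
proof -
  have "\<mu> = distr unit_lborel unit_square_borel (\<lambda>x. (x, f x))"
    by (rule induced_permuton_unique[OF induced induced_permuton_exists[OF measure_preserving]])
  also have "\<dots> = distr unit_lborel \<mu> (\<lambda>x. (x, f x))"
    using permuton by (intro distr_cong) (auto simp: permuton_def)
  finally show ?thesis ..
qed

lemma AE_graph: "AE z in \<mu>. snd z = f (fst z)"
proof -
  have to_borel: "g \<in> borel_measurable \<mu>" if "g \<in> \<mu> \<rightarrow>\<^sub>M unit_lborel" for g
    using that by (simp add: measurable_restrict_space2_iff)
  have "(\<lambda>z. f (fst z)) \<in> \<mu> \<rightarrow>\<^sub>M unit_lborel"
    by (rule measurable_compose[OF fst_measurable dyn.T_measurable])
  then have "{z \<in> space \<mu>. snd z = f (fst z)} \<in> sets \<mu>"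
    by (intro borel_measurable_eq to_borel snd_measurable)
  then have "AE z in distr unit_lborel \<mu> (\<lambda>x. (x, f x)). snd z = f (fst z)"
    by (subst AE_distr_iff[OF graph_measurable]) auto
  then show ?thesis by (simp only: distr_graph)
qed

definition xlab :: "real \<times> real \<Rightarrow> nat" where
  "xlab z = X (fst z)"

definition ylab :: "nat \<Rightarrow> real \<times> real \<Rightarrow> nat" where
  "ylab m z = grid m (snd z)"

lemma simple_xlab: "simple_function \<mu> xlab"
  unfolding xlab_def[abs_def] by (rule simple_function_comp[OF fst_measurable simple_X])

lemma simple_ylab: "simple_function \<mu> (ylab m)"
  unfolding ylab_def[abs_def] by (rule simple_function_comp[OF snd_measurable simple_function_grid])

lemma xlab_le: "z \<in> space \<mu> \<Longrightarrow> xlab z \<le> X 1"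
  using mono_onD[OF mono_X, of "fst z" 1] by (auto simp: xlab_def space_mu)

lemma ylab_le: "z \<in> space \<mu> \<Longrightarrow> ylab m z \<le> m"
  using grid_le[of "snd z" m] by (auto simp: ylab_def space_mu)

lemma cond_ent_labels:
  "cond_ent \<mu> xlab (ylab m) = cond_ent unit_lborel X (\<lambda>x. grid m (f x))"
proof -
  have "ent \<mu> g = ent unit_lborel (\<lambda>x. g (x, f x))" if "simple_function \<mu> g" for g :: "real \<times> real \<Rightarrow> 'z"
    using ent_distr[OF graph_measurable smp.prob_space_axioms that] by (simp only: distr_graph)
  from this[OF simple_ylab] have 1: "ent \<mu> (ylab m) = ent unit_lborel (\<lambda>x. grid m (f x))"
    by (simp add: ylab_def)
  have "ent \<mu> (\<lambda>z. (xlab z, ylab m z)) = ent unit_lborel (\<lambda>x. (X x, grid m (f x)))"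
    using ent_distr[OF graph_measurable smp.prob_space_axioms simple_function_Pair[OF simple_xlab simple_ylab]]
    by (simp only: distr_graph) (simp add: xlab_def ylab_def)
  with 1 show ?thesis by (simp add: cond_ent_def)
qed

definition height_rank :: "(nat \<Rightarrow> real \<times> real) \<Rightarrow> nat \<Rightarrow> nat" where
  "height_rank \<omega> = rank_among n (\<lambda>j. snd (\<omega> j))"

definition by_height :: "(real \<times> real \<Rightarrow> nat) \<Rightarrow> (nat \<Rightarrow> real \<times> real) \<Rightarrow> nat \<Rightarrow> nat" where
  "by_height g \<omega> = restrict (\<lambda>i. g (\<omega> (inv (height_rank \<omega>) i))) {1..n}"

lemma simple_height_rank: "simple_function smp.Om height_rank"
proof -
  have "simple_function smp.Om (\<lambda>\<omega>. height_rank \<omega> j)" if j: "j \<in> {1..n}" for j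
    unfolding simple_function_eq_measurable
  proof
    have "(\<lambda>\<omega>. height_rank \<omega> j) ` space smp.Om \<subseteq> {1..n}"
      using permutes_in_image[OF rank_among_permutes] j by (auto simp: height_rank_def)
    then show "finite ((\<lambda>\<omega>. height_rank \<omega> j) ` space smp.Om)" by (rule finite_subset) simp
    have "snd \<in> borel_measurable \<mu>"
      using snd_measurable by (simp add: measurable_restrict_space2_iff)
    then have "(\<lambda>\<omega>. snd (\<omega> k)) \<in> borel_measurable smp.Om" if "k \<in> {1..n}" for k
      by (rule measurable_compose[OF measurable_component_singleton[OF that]])
    then show "(\<lambda>\<omega>. height_rank \<omega> j) \<in> smp.Om \<rightarrow>\<^sub>M count_space UNIV"
      unfolding height_rank_def by (intro rank_among_measurable j)
  qed
  then have "simple_function smp.Om (\<lambda>\<omega>. restrict (\<lambda>j. height_rank \<omega> j) {1..n})"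
    by (intro simple_function_restrict) auto
  then have "simple_function smp.Om
      (\<lambda>\<omega>. (\<lambda>h j. if j \<in> {1..n} then h j else j) (restrict (\<lambda>j. height_rank \<omega> j) {1..n}))"
    by (rule simple_function_comp_left)
  moreover have "(\<lambda>h j. if j \<in> {1..n} then h j else j) (restrict (\<lambda>j. height_rank \<omega> j) {1..n}) = height_rank \<omega>" for \<omega>
    by (auto simp: fun_eq_iff height_rank_def rank_among_def)
  ultimately show ?thesis by simp
qed

lemma simple_by_height:
  assumes "simple_function \<mu> g"
  shows "simple_function smp.Om (by_height g)"
proof -
  have "simple_function smp.Om (\<lambda>\<omega>. (\<lambda>(p, h). restrict (\<lambda>i. h (inv p i)) {1..n})
      (height_rank \<omega>, restrict (\<lambda>i. g (\<omega> i)) {1..n}))"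
    by (rule simple_function_comp_left,
        rule simple_function_Pair[OF simple_height_rank smp.simple_components[OF assms]])
  moreover have "(\<lambda>(p, h). restrict (\<lambda>i. h (inv p i)) {1..n}) (height_rank \<omega>, restrict (\<lambda>i. g (\<omega> i)) {1..n})
      = by_height g \<omega>" for \<omega>
    by (auto simp: by_height_def fun_eq_iff height_rank_def inv_rank_in[simplified])
  ultimately show ?thesis by simp
qed

lemma by_height_apply: "i \<in> {1..n} \<Longrightarrow> by_height g \<omega> i = g (\<omega> (inv (height_rank \<omega>) i))"
  by (simp add: by_height_def)

lemma simple_pattern: "simple_function smp.Om (pattern n)"
proof -
  have m: "pattern n \<in> smp.Om \<rightarrow>\<^sub>M count_space {\<sigma>. \<sigma> permutes {1..n}}"
    using permuton by (intro pattern_measurable) (simp add: permuton_def)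
  have "pattern n ` space smp.Om \<subseteq> {\<sigma>. \<sigma> permutes {1..n}}" using pattern_permutes by blast
  then have "finite (pattern n ` space smp.Om)" by (rule finite_subset) (simp add: finite_permutations)
  moreover have "pattern n -` {\<sigma>} \<inter> space smp.Om \<in> sets smp.Om"
    if "\<sigma> \<in> pattern n ` space smp.Om" for \<sigma>
    using that pattern_permutes by (intro measurable_sets[OF m]) auto
  ultimately show ?thesis by (simp add: simple_function_def)
qed

lemma pattern_entropy_eq_ent: "pattern_entropy \<mu> n = ent smp.Om (pattern n)"
proof -
  let ?S = "{\<sigma>. \<sigma> permutes {1..n}}"
  have m: "pattern n \<in> smp.Om \<rightarrow>\<^sub>M count_space ?S"
    using permuton by (intro pattern_measurable) (simp add: permuton_def)
  have "measure (pattern_law \<mu> n) {\<sigma>} = level_prob smp.Om (pattern n) \<sigma>" if "\<sigma> \<in> ?S" for \<sigma>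
  proof -
    have "measure (distr smp.Om (count_space ?S) (pattern n)) {\<sigma>} =
        measure smp.Om (pattern n -` {\<sigma>} \<inter> space smp.Om)"
      by (rule measure_distr[OF m]) (use that in simp)
    also have "pattern n -` {\<sigma>} \<inter> space smp.Om = {\<omega> \<in> space smp.Om. pattern n \<omega> = \<sigma>}" by blast
    finally show ?thesis unfolding pattern_law_def level_prob_def .
  qed
  then have "pattern_entropy \<mu> n = shannon_entropy (level_prob smp.Om (pattern n)) ?S"
    by (simp add: pattern_entropy_def shannon_entropy_def)
  also have "\<dots> = ent smp.Om (pattern n)"
    using pattern_permutes
    by (intro smp.om.ent_eq_sum[symmetric] simple_pattern) (auto simp: finite_permutations)
  finally show ?thesis .
qed

definition collision :: "nat \<Rightarrow> (nat \<Rightarrow> real \<times> real) set" where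
  "collision m = {\<omega> \<in> space smp.Om. \<not> inj_on (\<lambda>i. ylab m (\<omega> i)) {1..n}}"

lemma collision_sets: "collision m \<in> sets smp.Om"
proof -
  have "collision m = {\<omega> \<in> space smp.Om. \<not> inj_on (restrict (\<lambda>i. ylab m (\<omega> i)) {1..n}) {1..n}}"
    by (auto simp: collision_def inj_on_def)
  then show ?thesis
    using smp.om.simple_level_set[OF smp.simple_components[OF simple_ylab], of "\<lambda>h. \<not> inj_on h {1..n}"]
    by simp
qed

lemma prob_ylab_le:
  assumes "m > 0"
  shows "level_prob \<mu> (ylab m) j \<le> 1 / real m"
proof -
  have "{x \<in> {0..1}. grid m x = j} = {x \<in> space unit_lborel. grid m x = j}" by (simp add: space_unit_lborel)
  then have s: "{x \<in> {0..1}. grid m x = j} \<in> sets unit_lborel"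
    using unit.simple_level_set[OF simple_function_grid, of "\<lambda>v. v = j" m] by simp
  have "level_prob \<mu> (ylab m) j = measure \<mu> (snd -` {x \<in> {0..1}. grid m x = j} \<inter> space \<mu>)"
    unfolding level_prob_def by (rule arg_cong[of _ _ "measure \<mu>"]) (auto simp: ylab_def space_mu)
  also have "\<dots> = measure (distr \<mu> unit_lborel snd) {x \<in> {0..1}. grid m x = j}"
    by (rule measure_distr[OF snd_measurable s, symmetric])
  also have "distr \<mu> unit_lborel snd = unit_lborel" using permuton by (simp add: permuton_def)
  also have "measure unit_lborel {x \<in> {0..1}. grid m x = j} = measure lborel {x \<in> {0..1}. grid m x = j}"
    using s by (subst measure_restrict_space) auto
  also have "\<dots> \<le> measure lborel {real j / real m .. (real j + 1) / real m}"
  proof (rule measure_mono_fmeasurable)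
    show "{x \<in> {0..1}. grid m x = j} \<subseteq> {real j / real m .. (real j + 1) / real m}"
    proof
      fix x assume x: "x \<in> {x \<in> {0..1}. grid m x = j}"
      then have "\<lfloor>real m * x\<rfloor> = int j" by (auto simp: grid_def nat_eq_iff2)
      then have "real j \<le> real m * x" "real m * x \<le> real j + 1" by linarith+
      then show "x \<in> {real j / real m .. (real j + 1) / real m}"
        using assms by (simp add: field_simps)
    qed
    show "{x \<in> {0..1}. grid m x = j} \<in> sets lborel" using s by (auto simp: sets_restrict_space_iff)
  qed (simp add: fmeasurable_def emeasure_lborel_Icc_eq)
  also have "\<dots> = 1 / real m" using assms by (simp add: field_simps)
  finally show ?thesis .
qed

text \<open>A union bound over pairs of points: a grid cell has probability at most \<open>1 / m\<close>, and so has the event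
  that two independent heights share one.\<close>

lemma prob_collision:
  assumes m: "m > 0"
  shows "measure smp.Om (collision m) \<le> (real n)\<^sup>2 / real m"
proof -
  define C where "C p = {\<omega> \<in> space smp.Om. ylab m (\<omega> (fst p)) = ylab m (\<omega> (snd p))}" for p
  let ?P = "{p \<in> {1..n} \<times> {1..n}. fst p \<noteq> snd p}"
  have simp2: "simple_function smp.Om (\<lambda>\<omega>. (ylab m (\<omega> k), ylab m (\<omega> l)))"
    if "k \<in> {1..n}" "l \<in> {1..n}" for k l
    using that by (intro simple_function_Pair smp.simple_component simple_ylab)
  have Cs: "C p \<in> sets smp.Om" if "p \<in> ?P" for p
    using smp.om.simple_level_set[OF simp2[of "fst p" "snd p"], of "\<lambda>(a, b). a = b"] that
    by (auto simp: C_def)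
  have C_le: "measure smp.Om (C p) \<le> 1 / real m" if p: "p \<in> ?P" for p
  proof -
    obtain k l where kl: "p = (k, l)" "k \<in> {1..n}" "l \<in> {1..n}" "k \<noteq> l" using p by auto
    have "C p = (\<Union>j\<in>{..m}. {\<omega> \<in> space smp.Om. \<forall>i\<in>{k, l}. \<omega> i \<in> {z \<in> space \<mu>. ylab m z = j}})"
      using kl ylab_le[OF sample_in_space] sample_in_space by (auto simp: C_def)
    also have "measure smp.Om \<dots> \<le> (\<Sum>j\<le>m. measure smp.Om {\<omega> \<in> space smp.Om. \<forall>i\<in>{k, l}. \<omega> i \<in> {z \<in> space \<mu>. ylab m z = j}})"
    proof (rule smp.om.finite_measure_subadditive_finite)
      have "{\<omega> \<in> space smp.Om. \<forall>i\<in>{k, l}. \<omega> i \<in> {z \<in> space \<mu>. ylab m z = j}} =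
          {\<omega> \<in> space smp.Om. (ylab m (\<omega> k), ylab m (\<omega> l)) = (j, j)}" for j
        using kl by (auto simp: space_PiM)
      then show "(\<lambda>j. {\<omega> \<in> space smp.Om. \<forall>i\<in>{k, l}. \<omega> i \<in> {z \<in> space \<mu>. ylab m z = j}}) ` {..m} \<subseteq> sets smp.Om"
        using smp.om.simple_level_set[OF simp2[OF kl(2,3)], of "\<lambda>v. v = _"] by auto
    qed simp
    also have "\<dots> = (\<Sum>j\<le>m. level_prob \<mu> (ylab m) j * level_prob \<mu> (ylab m) j)"
      using kl smp.simple_level_set[OF simple_ylab[of m], of "\<lambda>v. v = _"]
      by (intro sum.cong refl, subst smp.prob_all_in) (auto simp: level_prob_def)
    also have "\<dots> \<le> (\<Sum>j\<le>m. 1 / real m * level_prob \<mu> (ylab m) j)"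
      by (intro sum_mono mult_right_mono prob_ylab_le m) (simp add: smp.level_prob_nonneg)
    also have "\<dots> = 1 / real m * (\<Sum>j\<le>m. level_prob \<mu> (ylab m) j)"
      by (rule sum_distrib_left[symmetric])
    also have "(\<Sum>j\<le>m. level_prob \<mu> (ylab m) j) = 1"
      by (intro smp.sum_level_prob simple_ylab image_subsetI) (simp_all only: finite_atMost atMost_iff ylab_le)
    finally show ?thesis by simp
  qed
  have "collision m \<subseteq> (\<Union>p\<in>?P. C p)"
    by (fastforce simp: collision_def C_def inj_on_def)
  then have "measure smp.Om (collision m) \<le> measure smp.Om (\<Union>p\<in>?P. C p)"
    using Cs by (intro smp.om.finite_measure_mono) auto
  also have "\<dots> \<le> (\<Sum>p\<in>?P. measure smp.Om (C p))"
    using Cs by (intro smp.om.finite_measure_subadditive_finite) auto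
  also have "\<dots> \<le> (\<Sum>p\<in>?P. 1 / real m)" by (intro sum_mono C_le)
  also have "\<dots> \<le> (\<Sum>p\<in>{1..n} \<times> {1..n}. 1 / real m)" by (intro sum_mono2) auto
  also have "\<dots> = (real n)\<^sup>2 / real m" by (simp add: power2_eq_square)
  finally show ?thesis .
qed

text \<open>Equal heights collide in every grid.\<close>

lemma AE_distinct_heights: "AE \<omega> in smp.Om. inj_on (\<lambda>i. snd (\<omega> i)) {1..n}"
proof (rule AE_I)
  let ?N = "\<Inter>m. collision (Suc m)"
  show "{\<omega> \<in> space smp.Om. \<not> inj_on (\<lambda>i. snd (\<omega> i)) {1..n}} \<subseteq> ?N"
    using inj_on_imageI2[of "grid _" "\<lambda>i. snd (_ i)" "{1..n}"]
    by (auto simp: collision_def ylab_def comp_def)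
  show N: "?N \<in> sets smp.Om" by (intro sets.countable_INT image_subsetI collision_sets) simp
  have "measure smp.Om ?N \<le> (real n)\<^sup>2 / real (Suc m)" for m
  proof -
    have "measure smp.Om ?N \<le> measure smp.Om (collision (Suc m))"
      by (intro smp.om.finite_measure_mono collision_sets) auto
    also have "\<dots> \<le> (real n)\<^sup>2 / real (Suc m)" by (rule prob_collision) simp
    finally show ?thesis .
  qed
  then have "measure smp.Om ?N \<le> 0"
    by (intro LIMSEQ_le_const[OF LIMSEQ_Suc[OF lim_const_over_n[of "(real n)\<^sup>2"]]]) auto
  then have "measure smp.Om ?N = 0" by (simp add: order_antisym)
  then show "emeasure smp.Om ?N = 0" by (simp only: smp.om.emeasure_eq_measure ennreal_0)
qed

end

section \<open>Bounds on the entropy of the pattern\<close>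

context sampled_map
begin

lemma inv_height_rank_in: "i \<in> {1..n} \<Longrightarrow> inv (height_rank \<omega>) i \<in> {1..n}"
  unfolding height_rank_def by (rule inv_rank_in)

lemma height_rank_inv: "height_rank \<omega> (inv (height_rank \<omega>) i) = i"
  unfolding height_rank_def by (rule rank_inv_rank)

lemma bij_inv_height_rank: "bij_betw (inv (height_rank \<omega>)) {1..n} {1..n}"
  unfolding height_rank_def by (rule permutes_imp_bij[OF permutes_inv[OF rank_among_permutes]])

definition label_counts :: "(real \<times> real \<Rightarrow> nat) \<Rightarrow> nat \<Rightarrow> (nat \<Rightarrow> real \<times> real) \<Rightarrow> nat \<Rightarrow> nat" where
  "label_counts g b \<omega> = restrict (\<lambda>j. card {k \<in> {1..n}. g (\<omega> k) \<le> j}) {..b}"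

lemma label_counts_apply: "j \<le> b \<Longrightarrow> label_counts g b \<omega> j = card {k \<in> {1..n}. g (\<omega> k) \<le> j}"
  by (simp add: label_counts_def)

lemma simple_label_counts:
  assumes "simple_function \<mu> g"
  shows "simple_function smp.Om (label_counts g b)"
proof -
  have "simple_function smp.Om
      (\<lambda>\<omega>. (\<lambda>h. restrict (\<lambda>j. card {k \<in> {1..n}. h k \<le> j}) {..b}) (restrict (\<lambda>i. g (\<omega> i)) {1..n}))"
    by (rule simple_function_comp_left[OF smp.simple_components[OF assms]])
  moreover have "{k \<in> {1..n}. restrict (\<lambda>i. g (\<omega> i)) {1..n} k \<le> j} = {k \<in> {1..n}. g (\<omega> k) \<le> j}" for \<omega> j
    by auto
  ultimately show ?thesis by (simp only: label_counts_def[abs_def])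
qed

lemma ent_label_counts_le:
  assumes "simple_function \<mu> g"
  shows "ent smp.Om (label_counts g b) \<le> real (b + 1) * ln (real (n + 1))"
proof -
  let ?R = "{..b} \<rightarrow>\<^sub>E {..n}"
  have le: "card {k \<in> {1..n}. P k} \<le> n" for P
  proof -
    have "card {k \<in> {1..n}. P k} \<le> card {1..n}" by (rule card_mono) auto
    then show ?thesis by simp
  qed
  have "ent smp.Om (label_counts g b) \<le> ln (card ?R)"
  proof (rule smp.om.ent_le_ln_card[OF simple_label_counts[OF assms]])
    show "finite ?R" by (intro finite_PiE) auto
    show "label_counts g b ` space smp.Om \<subseteq> ?R"
      unfolding label_counts_def
      by (intro image_subsetI restrict_PiE_iff[THEN iffD2] ballI) (simp only: atMost_iff le)
  qed
  also have "card ?R = (n + 1) ^ (b + 1)" by (simp add: card_funcsetE)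
  also have "ln (real ((n + 1) ^ (b + 1))) = real (b + 1) * ln (real (n + 1))"
    by (simp only: of_nat_power ln_realpow)
  finally show ?thesis .
qed

lemma ylab_le_iff:
  assumes "\<omega> \<in> space smp.Om" "l \<in> {1..n}"
  shows "ylab m (\<omega> l) \<le> j \<longleftrightarrow> height_rank \<omega> l \<le> card {k \<in> {1..n}. ylab m (\<omega> k) \<le> j}"
  unfolding ylab_def height_rank_def
  by (rule label_le_iff_rank_le[OF mono_grid]) (use assms sample_in in auto)

lemma xlab_le_iff:
  assumes "\<omega> \<in> space smp.Om" "l \<in> {1..n}"
  shows "xlab (\<omega> l) \<le> j \<longleftrightarrow> rank_among n (\<lambda>k. fst (\<omega> k)) l \<le> card {k \<in> {1..n}. xlab (\<omega> k) \<le> j}"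
  unfolding xlab_def
  by (rule label_le_iff_rank_le[OF mono_X]) (use assms sample_in in auto)

text \<open>A sorted word is determined by its letter counts, so it carries only logarithmic entropy.\<close>

lemma ent_by_height_ylab_le: "ent smp.Om (by_height (ylab m)) \<le> real (m + 1) * ln (real (n + 1))"
proof -
  have le: "by_height (ylab m) \<omega> i \<le> by_height (ylab m) \<omega>' i"
    if "\<omega> \<in> space smp.Om" "\<omega>' \<in> space smp.Om" "i \<in> {1..n}"
      "label_counts (ylab m) m \<omega> = label_counts (ylab m) m \<omega>'" for \<omega> \<omega>' i
  proof -
    let ?c = "by_height (ylab m) \<omega>' i"
    have c: "?c = ylab m (\<omega>' (inv (height_rank \<omega>') i))"
      "by_height (ylab m) \<omega> i = ylab m (\<omega> (inv (height_rank \<omega>) i))"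
      using that(3) by (simp_all only: by_height_apply)
    have "?c \<le> m" unfolding c by (rule ylab_le[OF sample_in_space[OF that(2) inv_height_rank_in[OF that(3)]]])
    then have "card {k \<in> {1..n}. ylab m (\<omega> k) \<le> ?c} = card {k \<in> {1..n}. ylab m (\<omega>' k) \<le> ?c}"
      using fun_cong[OF that(4), of ?c] by (simp only: label_counts_apply)
    moreover have "i \<le> card {k \<in> {1..n}. ylab m (\<omega>' k) \<le> ?c}"
      using ylab_le_iff[OF that(2) inv_height_rank_in[OF that(3)], of m \<omega>' ?c]
      by (simp only: c(1) height_rank_inv order_refl)
    ultimately show ?thesis
      using ylab_le_iff[OF that(1) inv_height_rank_in[OF that(3)], of m \<omega> ?c]
      by (simp only: c(2) height_rank_inv)
  qed
  have "ent smp.Om (by_height (ylab m)) \<le> ent smp.Om (label_counts (ylab m) m)"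
  proof (rule smp.om.ent_mono[OF simple_by_height[OF simple_ylab] simple_label_counts[OF simple_ylab]])
    fix \<omega> \<omega>' assume w: "\<omega> \<in> space smp.Om" "\<omega>' \<in> space smp.Om"
      "label_counts (ylab m) m \<omega> = label_counts (ylab m) m \<omega>'"
    show "by_height (ylab m) \<omega> = by_height (ylab m) \<omega>'"
    proof
      fix i show "by_height (ylab m) \<omega> i = by_height (ylab m) \<omega>' i"
      proof (cases "i \<in> {1..n}")
        case True
        then show ?thesis using le[OF w(1,2) True w(3)] le[OF w(2,1) True w(3)[symmetric]] by simp
      qed (simp only: by_height_def restrict_apply if_False)
    qed
  qed
  also have "\<dots> \<le> real (m + 1) * ln (real (n + 1))"
    by (rule ent_label_counts_le[OF simple_ylab])
  finally show ?thesis .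
qed

text \<open>Given the grid cells of the heights, guess the pieces independently with the conditional law of a
  single point. The cross entropy of this guess is a sum over the points of the sample, in which the
  order no longer matters; so it is exactly \<open>n\<close> times the conditional entropy for one point.\<close>

lemma cond_ent_by_height_le:
  "cond_ent smp.Om (by_height xlab) (by_height (ylab m)) \<le> real n * cond_ent \<mu> xlab (ylab m)"
proof -
  let ?W = "\<lambda>z. (xlab z, ylab m z)"
  have W: "simple_function \<mu> ?W" by (rule simple_function_Pair[OF simple_xlab simple_ylab])
  define p where "p a c = level_prob \<mu> ?W (a, c) / level_prob \<mu> (ylab m) c" for a c
  define q where "q b c = (\<Prod>i\<in>{1..n}. p (b i) (c i))" for b c
  have p_nn: "0 \<le> p a c" for a c by (simp add: p_def smp.level_prob_nonneg)
  have p_sum: "(\<Sum>a\<in>xlab ` space \<mu>. p a c) \<le> 1" for c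
  proof -
    have ms: "{z \<in> space \<mu>. xlab z = a \<and> ylab m z = c} \<in> sets \<mu>" for a
      using smp.simple_level_set[OF W, of "\<lambda>w. w = (a, c)"] by simp
    have "{z \<in> space \<mu>. ylab m z = c} = (\<Union>a\<in>xlab ` space \<mu>. {z \<in> space \<mu>. xlab z = a \<and> ylab m z = c})" by auto
    then have "level_prob \<mu> (ylab m) c = measure \<mu> (\<Union>a\<in>xlab ` space \<mu>. {z \<in> space \<mu>. xlab z = a \<and> ylab m z = c})"
      by (simp only: level_prob_def)
    also have "\<dots> = (\<Sum>a\<in>xlab ` space \<mu>. level_prob \<mu> ?W (a, c))"
      using simple_functionD(1)[OF simple_xlab] ms
      by (subst smp.finite_measure_finite_Union) (auto simp: disjoint_family_on_def level_prob_def)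
    finally show ?thesis by (simp add: p_def flip: sum_divide_distrib)
  qed
  have AEp: "AE \<omega> in smp.Om. \<forall>i\<in>{1..n}. 0 < p (xlab (\<omega> i)) (ylab m (\<omega> i))"
    using smp.AE_level_prob_pos[OF W] smp.AE_level_prob_pos[OF simple_ylab[of m]]
    by (intro smp.AE_all_components, eventually_elim) (simp add: p_def)
  have q_eq: "q (by_height xlab \<omega>) (by_height (ylab m) \<omega>) = (\<Prod>i\<in>{1..n}. p (xlab (\<omega> i)) (ylab m (\<omega> i)))" for \<omega>
  proof -
    have "q (by_height xlab \<omega>) (by_height (ylab m) \<omega>) =
        (\<Prod>i\<in>{1..n}. p (xlab (\<omega> (inv (height_rank \<omega>) i))) (ylab m (\<omega> (inv (height_rank \<omega>) i))))"
      unfolding q_def by (intro prod.cong refl) (simp only: by_height_apply)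
    also have "\<dots> = (\<Prod>i\<in>{1..n}. p (xlab (\<omega> i)) (ylab m (\<omega> i)))"
      by (rule prod.reindex_bij_betw[OF bij_inv_height_rank])
    finally show ?thesis .
  qed
  have "cond_ent smp.Om (by_height xlab) (by_height (ylab m)) \<le>
      (\<integral>\<omega>. - ln (q (by_height xlab \<omega>) (by_height (ylab m) \<omega>)) \<partial>smp.Om)"
  proof (rule smp.om.cond_ent_le_cross[OF simple_by_height[OF simple_xlab] simple_by_height[OF simple_ylab]])
    show "0 \<le> q b c" for b c unfolding q_def by (intro prod_nonneg ballI p_nn)
    show "AE \<omega> in smp.Om. 0 < q (by_height xlab \<omega>) (by_height (ylab m) \<omega>)"
      using AEp by eventually_elim (simp only: q_eq prod_pos)
    show "(\<Sum>b\<in>by_height xlab ` space smp.Om. q b c) \<le> 1" for c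
    proof -
      have fin: "finite (xlab ` space \<mu>)" by (rule simple_functionD(1)[OF simple_xlab])
      have "(\<Sum>b\<in>by_height xlab ` space smp.Om. q b c) \<le> (\<Sum>b\<in>{1..n} \<rightarrow>\<^sub>E xlab ` space \<mu>. q b c)"
      proof (rule sum_mono2)
        show "finite ({1..n} \<rightarrow>\<^sub>E xlab ` space \<mu>)" using fin by (intro finite_PiE) auto
        show "by_height xlab ` space smp.Om \<subseteq> {1..n} \<rightarrow>\<^sub>E xlab ` space \<mu>"
        proof (intro image_subsetI PiE_I)
          fix \<omega> i assume "\<omega> \<in> space smp.Om" "i \<in> {1..n}"
          then show "by_height xlab \<omega> i \<in> xlab ` space \<mu>"
            using sample_in_space[OF _ inv_height_rank_in] by (simp only: by_height_apply imageI)
        qed (simp only: by_height_def restrict_apply if_False)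
        show "0 \<le> q b c" for b unfolding q_def by (intro prod_nonneg ballI p_nn)
      qed
      also have "\<dots> = (\<Prod>i\<in>{1..n}. \<Sum>a\<in>xlab ` space \<mu>. p a (c i))"
        unfolding q_def using fin by (intro prod_sum_PiE[symmetric]) auto
      also have "\<dots> \<le> 1"
        by (intro prod_le_1 conjI sum_nonneg p_nn p_sum)
      finally show ?thesis .
    qed
  qed
  also have "\<dots> = (\<integral>\<omega>. (\<Sum>i\<in>{1..n}. - ln (p (xlab (\<omega> i)) (ylab m (\<omega> i)))) \<partial>smp.Om)"
  proof (rule integral_cong_AE)
    show "(\<lambda>\<omega>. - ln (q (by_height xlab \<omega>) (by_height (ylab m) \<omega>))) \<in> borel_measurable smp.Om"
      using smp.om.integrable_of_simple[OF simple_function_Pair[OF simple_by_height[OF simple_xlab] simple_by_height[OF simple_ylab]],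
          of "\<lambda>(b, c). - ln (q b c)"] by auto
    show "(\<lambda>\<omega>. \<Sum>i\<in>{1..n}. - ln (p (xlab (\<omega> i)) (ylab m (\<omega> i)))) \<in> borel_measurable smp.Om"
    proof (rule borel_measurable_sum)
      fix i assume "i \<in> {1..n}"
      then show "(\<lambda>\<omega>. - ln (p (xlab (\<omega> i)) (ylab m (\<omega> i)))) \<in> borel_measurable smp.Om"
        using smp.om.integrable_of_simple[OF smp.simple_component[OF _ W], of i "\<lambda>(a, c). - ln (p a c)"] by auto
    qed
    show "AE \<omega> in smp.Om. - ln (q (by_height xlab \<omega>) (by_height (ylab m) \<omega>)) =
        (\<Sum>i\<in>{1..n}. - ln (p (xlab (\<omega> i)) (ylab m (\<omega> i))))"
      using AEp
    proof eventually_elim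
      case (elim \<omega>)
      then have "ln (\<Prod>i\<in>{1..n}. p (xlab (\<omega> i)) (ylab m (\<omega> i))) = (\<Sum>i\<in>{1..n}. ln (p (xlab (\<omega> i)) (ylab m (\<omega> i))))"
        by (intro ln_prod) force+
      then show ?case by (simp only: q_eq sum_negf)
    qed
  qed
  also have "\<dots> = (\<Sum>i\<in>{1..n}. (\<integral>\<omega>. - ln (p (xlab (\<omega> i)) (ylab m (\<omega> i))) \<partial>smp.Om))"
  proof (rule Bochner_Integration.integral_sum)
    fix i assume "i \<in> {1..n}"
    then show "integrable smp.Om (\<lambda>\<omega>. - ln (p (xlab (\<omega> i)) (ylab m (\<omega> i))))"
      using smp.om.integrable_of_simple[OF smp.simple_component[OF _ W], of i "\<lambda>(a, c). - ln (p a c)"] by auto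
  qed
  also have "\<dots> = (\<Sum>i\<in>{1..n}. (\<integral>z. - ln (p (xlab z) (ylab m z)) \<partial>\<mu>))"
    using smp.integrable_of_simple[OF W, of "\<lambda>(a, c). - ln (p a c)"]
    by (intro sum.cong refl smp.expectation_component[where h = "\<lambda>z. - ln (p (xlab z) (ylab m z))"]) auto
  also have "\<dots> = real n * (\<integral>z. - ln (p (xlab z) (ylab m z)) \<partial>\<mu>)" by simp
  also have "(\<integral>z. - ln (p (xlab z) (ylab m z)) \<partial>\<mu>) =
      (\<integral>z. - ln (level_prob \<mu> ?W (?W z)) - - ln (level_prob \<mu> (ylab m) (ylab m z)) \<partial>\<mu>)"
  proof (rule integral_cong_AE)
    show "AE z in \<mu>. - ln (p (xlab z) (ylab m z)) =
        - ln (level_prob \<mu> ?W (?W z)) - - ln (level_prob \<mu> (ylab m) (ylab m z))"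
      using smp.AE_level_prob_pos[OF W] smp.AE_level_prob_pos[OF simple_ylab[of m]]
      by eventually_elim (simp add: p_def ln_div)
    show "(\<lambda>z. - ln (p (xlab z) (ylab m z))) \<in> borel_measurable \<mu>"
      using smp.integrable_of_simple[OF W, of "\<lambda>(a, c). - ln (p a c)"] by auto
    show "(\<lambda>z. - ln (level_prob \<mu> ?W (?W z)) - - ln (level_prob \<mu> (ylab m) (ylab m z))) \<in> borel_measurable \<mu>"
      using smp.integrable_ln_level_prob[OF W] smp.integrable_ln_level_prob[OF simple_ylab[of m]] by auto
  qed
  also have "\<dots> = cond_ent \<mu> xlab (ylab m)"
    unfolding cond_ent_def ent_def
    by (rule Bochner_Integration.integral_diff[OF smp.integrable_ln_level_prob[OF W] smp.integrable_ln_level_prob[OF simple_ylab]])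
  finally show ?thesis .
qed

text \<open>The comparison of two points from left to right is visible in the pieces listed by height: on different
  pieces the order is that of the pieces, and on the same piece it is the order of heights or its
  reverse, according to the direction of \<open>f\<close> there.\<close>

lemma sorted_left_rank:
  assumes w: "\<omega> \<in> space smp.Om" and graph: "\<forall>i\<in>{1..n}. snd (\<omega> i) = f (fst (\<omega> i))"
    and inj: "inj_on (\<lambda>i. snd (\<omega> i)) {1..n}" and i: "i \<in> {1..n}"
  shows "rank_among n (\<lambda>k. fst (\<omega> k)) (inv (height_rank \<omega>) i) =
    card {j \<in> {1..n}. by_height xlab \<omega> j < by_height xlab \<omega> i \<or> by_height xlab \<omega> j = by_height xlab \<omega> i \<and>
      (if monotone_on {x \<in> {0..1}. X x = by_height xlab \<omega> i} (<) (<) f then j \<le> i else i \<le> j)}"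
proof -
  let ?t = "inv (height_rank \<omega>)"
  define x where "x j = fst (\<omega> (?t j))" for j
  have t: "?t j \<in> {1..n}" if "j \<in> {1..n}" for j by (rule inv_height_rank_in[OF that])
  have x01: "x j \<in> {0..1}" if "j \<in> {1..n}" for j unfolding x_def by (rule sample_in[OF w t[OF that]])
  have lab: "by_height xlab \<omega> j = X (x j)" if "j \<in> {1..n}" for j
    using that by (simp only: by_height_apply xlab_def x_def)
  have snd_t: "snd (\<omega> (?t j)) = f (x j)" if "j \<in> {1..n}" for j
    unfolding x_def using graph t[OF that] by blast
  have inj_t: "?t j = ?t k \<Longrightarrow> j = k" for j k
    by (metis height_rank_inv)
  have fx_less: "f (x j) < f (x k) \<longleftrightarrow> j < k" if jk: "j \<in> {1..n}" "k \<in> {1..n}" for j k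
  proof -
    have "snd (\<omega> (?t j)) = snd (\<omega> (?t k)) \<longleftrightarrow> j = k"
      using inj_onD[OF inj _ t[OF jk(1)] t[OF jk(2)]] inj_t by blast
    then show ?thesis
      using rank_among_less_iff[OF t[OF jk(1)] t[OF jk(2)], of "\<lambda>j. snd (\<omega> j)"]
      unfolding height_rank_def[symmetric] height_rank_inv snd_t[OF jk(1)] snd_t[OF jk(2)]
      by (metis less_irrefl)
  qed
  have x_eq: "x j = x k \<longleftrightarrow> j = k" if "j \<in> {1..n}" "k \<in> {1..n}" for j k
    using fx_less[OF that] fx_less[OF that(2,1)] by (metis less_irrefl linorder_neqE_nat)
  have x_le: "x j \<le> x i \<longleftrightarrow> X (x j) < X (x i) \<or> X (x j) = X (x i) \<and>
      (if monotone_on {z \<in> {0..1}. X z = X (x i)} (<) (<) f then j \<le> i else i \<le> j)"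
    if j: "j \<in> {1..n}" for j
  proof (cases "X (x j) = X (x i)")
    case False
    have "X (x j) \<le> X (x i)" if "x j \<le> x i"
      using that by (intro mono_onD[OF mono_X] x01 j i)
    moreover have "X (x i) \<le> X (x j)" if "x i \<le> x j"
      using that by (intro mono_onD[OF mono_X] x01 j i)
    ultimately show ?thesis using False by (meson linorder_not_le nat_less_le linear order_antisym)
  next
    case True
    let ?S = "{z \<in> {0..1}. X z = X (x i)}"
    have S: "x i \<in> ?S" "x j \<in> ?S" using x01 i j True by auto
    show ?thesis
    proof (cases "monotone_on ?S (<) (<) f")
      case inc: True
      have "x j < x i \<Longrightarrow> j < i" "x i < x j \<Longrightarrow> i < j"
        using monotone_onD[OF inc S(2,1)] monotone_onD[OF inc S(1,2)] fx_less[OF i j] fx_less[OF j i] by auto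
      then show ?thesis using inc True x_eq[OF i j] x_eq[OF j i]
        by (metis less_irrefl linorder_neqE order_less_le not_le)
    next
      case False
      then have dec: "monotone_on ?S (<) (>) f" using strict[of "X (x i)"] by blast
      have "x j < x i \<Longrightarrow> i < j" "x i < x j \<Longrightarrow> j < i"
        using monotone_onD[OF dec S(2,1)] monotone_onD[OF dec S(1,2)] fx_less[OF i j] fx_less[OF j i] by auto
      then show ?thesis using False True x_eq[OF i j] x_eq[OF j i]
        by (metis less_irrefl linorder_neqE order_less_le not_le)
    qed
  qed
  have "rank_among n (\<lambda>k. fst (\<omega> k)) (?t i) =
      card {k \<in> {1..n}. fst (\<omega> k) < x i \<or> fst (\<omega> k) = x i \<and> k \<le> ?t i}"
    using t[OF i] by (simp only: rank_among_def if_True x_def)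
  also have "\<dots> = card {j \<in> {1..n}. x j < x i \<or> x j = x i \<and> ?t j \<le> ?t i}"
    unfolding x_def height_rank_def by (rule card_sorted)
  also have "{j \<in> {1..n}. x j < x i \<or> x j = x i \<and> ?t j \<le> ?t i} = {j \<in> {1..n}. x j \<le> x i}"
    using x_eq[OF _ i] by (intro Collect_cong conj_cong refl) (auto simp: order_le_less)
  also have "\<dots> = {j \<in> {1..n}. by_height xlab \<omega> j < by_height xlab \<omega> i \<or> by_height xlab \<omega> j = by_height xlab \<omega> i \<and>
      (if monotone_on {x \<in> {0..1}. X x = by_height xlab \<omega> i} (<) (<) f then j \<le> i else i \<le> j)}"
    by (intro Collect_cong conj_cong refl) (simp only: x_le lab lab[OF i])
  finally show ?thesis .
qed

lemma pattern_determined: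
  assumes "\<omega> \<in> space smp.Om" "\<forall>i\<in>{1..n}. snd (\<omega> i) = f (fst (\<omega> i))" "inj_on (\<lambda>i. snd (\<omega> i)) {1..n}"
    and "\<omega>' \<in> space smp.Om" "\<forall>i\<in>{1..n}. snd (\<omega>' i) = f (fst (\<omega>' i))" "inj_on (\<lambda>i. snd (\<omega>' i)) {1..n}"
    and eq: "by_height xlab \<omega> = by_height xlab \<omega>'"
  shows "pattern n \<omega> = pattern n \<omega>'"
proof -
  let ?x = "\<lambda>\<omega>. rank_among n (\<lambda>k. fst (\<omega> k))"
  have bx: "bij (?x \<omega>)" and bh: "bij (height_rank \<omega>)" for \<omega> :: "nat \<Rightarrow> real \<times> real"
    unfolding height_rank_def by (rule permutes_bij[OF rank_among_permutes])+
  have inv: "pattern n \<omega> = inv (?x \<omega> \<circ> inv (height_rank \<omega>))" for \<omega>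
    using bx[of \<omega>] bh[of \<omega>] unfolding pattern_def height_rank_def[symmetric]
    by (simp add: o_inv_distrib bij_imp_bij_inv inv_inv_eq)
  have "?x \<omega> \<circ> inv (height_rank \<omega>) = ?x \<omega>' \<circ> inv (height_rank \<omega>')"
  proof
    fix i
    show "(?x \<omega> \<circ> inv (height_rank \<omega>)) i = (?x \<omega>' \<circ> inv (height_rank \<omega>')) i"
    proof (cases "i \<in> {1..n}")
      case True
      show ?thesis
        unfolding comp_apply sorted_left_rank[OF assms(1-3) True] sorted_left_rank[OF assms(4-6) True] eq ..
    next
      case False
      have "inv (height_rank \<omega>) i = i" for \<omega>
        unfolding height_rank_def using False by (rule permutes_not_in[OF permutes_inv[OF rank_among_permutes]])
      then show ?thesis using False by (simp add: permutes_not_in[OF rank_among_permutes])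
    qed
  qed
  then show ?thesis by (simp only: inv)
qed

lemma pattern_entropy_le:
  "pattern_entropy \<mu> n \<le> real (m + 1) * ln (real (n + 1)) + real n * cond_ent unit_lborel X (\<lambda>x. grid m (f x))"
proof -
  let ?b = "by_height xlab" and ?c = "by_height (ylab m)"
  have b: "simple_function smp.Om ?b" and c: "simple_function smp.Om ?c"
    by (rule simple_by_height[OF simple_xlab] simple_by_height[OF simple_ylab])+
  have "ent smp.Om (pattern n) \<le> ent smp.Om ?b"
  proof (rule smp.om.ent_mono_AE[OF simple_pattern b])
    show "AE \<omega> in smp.Om. (\<forall>i\<in>{1..n}. snd (\<omega> i) = f (fst (\<omega> i))) \<and> inj_on (\<lambda>i. snd (\<omega> i)) {1..n}"
      using smp.AE_all_components[OF AE_graph] AE_distinct_heights by (rule AE_conjI)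
  qed (use pattern_determined in blast)
  also have "\<dots> \<le> ent smp.Om (\<lambda>\<omega>. (?b \<omega>, ?c \<omega>))"
    by (intro smp.om.ent_mono b simple_function_Pair c) simp
  also have "\<dots> = ent smp.Om ?c + cond_ent smp.Om ?b ?c" by (simp add: cond_ent_def)
  also have "\<dots> \<le> real (m + 1) * ln (real (n + 1)) + real n * cond_ent \<mu> xlab (ylab m)"
    by (intro add_mono ent_by_height_ylab_le cond_ent_by_height_le)
  finally show ?thesis by (simp only: pattern_entropy_eq_ent cond_ent_labels)
qed

text \<open>When the grid separates the heights, it shows their order.\<close>

lemma height_rank_determined:
  assumes "inj_on (\<lambda>i. ylab m (\<omega> i)) {1..n}" "inj_on (\<lambda>i. ylab m (\<omega>' i)) {1..n}"
    and "\<omega> \<in> space smp.Om" "\<omega>' \<in> space smp.Om" and eq: "\<And>i. i \<in> {1..n} \<Longrightarrow> ylab m (\<omega> i) = ylab m (\<omega>' i)"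
  shows "height_rank \<omega> = height_rank \<omega>'"
proof -
  have less: "snd (\<omega> k) < snd (\<omega> l) \<or> (snd (\<omega> k) = snd (\<omega> l) \<and> k \<le> l) \<longleftrightarrow> ylab m (\<omega> k) \<le> ylab m (\<omega> l)"
    if w: "\<omega> \<in> space smp.Om" "inj_on (\<lambda>i. ylab m (\<omega> i)) {1..n}" "k \<in> {1..n}" "l \<in> {1..n}" for \<omega> k l
  proof -
    have 1: "ylab m (\<omega> k) \<le> ylab m (\<omega> l)" if "snd (\<omega> k) \<le> snd (\<omega> l)"
      unfolding ylab_def using that w by (intro mono_onD[OF mono_grid] sample_in)
    have 2: "ylab m (\<omega> l) \<le> ylab m (\<omega> k)" if "snd (\<omega> l) \<le> snd (\<omega> k)"
      unfolding ylab_def using that w by (intro mono_onD[OF mono_grid] sample_in)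
    have 3: "k = l" if "ylab m (\<omega> k) = ylab m (\<omega> l)" using inj_onD[OF w(2) that w(3,4)] .
    show ?thesis using 1 2 3 by (metis linorder_le_cases order_antisym order_less_le order_refl not_le)
  qed
  show ?thesis
  proof
    fix l show "height_rank \<omega> l = height_rank \<omega>' l"
    proof (cases "l \<in> {1..n}")
      case True
      have "{k \<in> {1..n}. snd (\<omega> k) < snd (\<omega> l) \<or> (snd (\<omega> k) = snd (\<omega> l) \<and> k \<le> l)} =
          {k \<in> {1..n}. snd (\<omega>' k) < snd (\<omega>' l) \<or> (snd (\<omega>' k) = snd (\<omega>' l) \<and> k \<le> l)}"
        by (intro Collect_cong conj_cong refl)
          (simp only: less[OF assms(3,1) _ True] less[OF assms(4,2) _ True] eq eq[OF True])
      then show ?thesis using True by (simp only: height_rank_def rank_among_def if_True)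
    qed (simp only: height_rank_def rank_among_def if_False)
  qed
qed

text \<open>The pattern converts height ranks into left-to-right ranks, and these together with the counts give the
  pieces. Only one inequality is stated because the hypotheses are symmetric in the two samples.\<close>

lemma xlab_determined:
  assumes w: "\<omega> \<in> space smp.Om" "\<omega>' \<in> space smp.Om"
    and hr: "height_rank \<omega> = height_rank \<omega>'" and pat: "pattern n \<omega> = pattern n \<omega>'"
    and cnt: "label_counts xlab (X 1) \<omega> = label_counts xlab (X 1) \<omega>'" and l: "l \<in> {1..n}"
  shows "xlab (\<omega> l) \<le> xlab (\<omega>' l)"
proof -
  let ?x = "\<lambda>\<omega>. rank_among n (\<lambda>k. fst (\<omega> k))"
  have bx: "bij (?x \<omega>)" and bh: "bij (height_rank \<omega>)" for \<omega> :: "nat \<Rightarrow> real \<times> real"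
    unfolding height_rank_def by (rule permutes_bij[OF rank_among_permutes])+
  have "pattern n \<omega> (?x \<omega> l) = height_rank \<omega> l" for \<omega>
    unfolding pattern_def height_rank_def[symmetric] using bij_is_inj[OF bx[of \<omega>]] by simp
  then have "pattern n \<omega> (?x \<omega> l) = pattern n \<omega> (?x \<omega>' l)" using hr pat by metis
  then have x: "?x \<omega> l = ?x \<omega>' l"
    using bij_is_inj[OF permutes_bij[OF pattern_permutes]] by (simp add: inj_eq)
  let ?j = "xlab (\<omega>' l)"
  have "?j \<le> X 1" by (rule xlab_le[OF sample_in_space[OF w(2) l]])
  then have "card {k \<in> {1..n}. xlab (\<omega> k) \<le> ?j} = card {k \<in> {1..n}. xlab (\<omega>' k) \<le> ?j}"
    using fun_cong[OF cnt, of ?j] by (simp only: label_counts_apply)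
  moreover have "?x \<omega>' l \<le> card {k \<in> {1..n}. xlab (\<omega>' k) \<le> ?j}"
    using xlab_le_iff[OF w(2) l, of ?j] by simp
  ultimately show ?thesis using xlab_le_iff[OF w(1) l, of ?j] by (simp only: x)
qed

text \<open>Off the collision event, the pattern, the counts of the pieces, and the grid cells of the heights
  determine on which pieces all the points lie. These pieces have entropy at least \<open>n\<close> times the branch
  entropy given the grid cells, because the points are independent; so the pattern must supply it, up
  to the logarithmic share of the counts and the error from Fano's inequality.\<close>

lemma pattern_entropy_ge:
  assumes n: "n > 0"
  shows "real n * branch_entropy \<le> pattern_entropy \<mu> n + real (X 1 + 1) * ln (real (n + 1)) + ln 2
    + ln (real (X 1 + 1)) + ln 2"
proof -
  \<comment> \<open>The square of \<open>n\<close> bounds the number of pairs, and one more factor \<open>n\<close> offsets the entropy of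
    \<open>n\<close> labels on the collision event.\<close>
  define m where "m = n ^ 3"
  have m: "m > 0" using n by (simp add: m_def)
  let ?a = "\<lambda>\<omega>. restrict (\<lambda>i. xlab (\<omega> i)) {1..n}" and ?c = "\<lambda>\<omega>. restrict (\<lambda>i. ylab m (\<omega> i)) {1..n}"
  let ?T = "\<lambda>\<omega>. (pattern n \<omega>, label_counts xlab (X 1) \<omega>)"
  let ?R = "{1..n} \<rightarrow>\<^sub>E {..X 1}"
  have a: "simple_function smp.Om ?a" by (rule smp.simple_components[OF simple_xlab])
  have c: "simple_function smp.Om ?c" by (rule smp.simple_components[OF simple_ylab])
  have T: "simple_function smp.Om ?T" by (rule simple_function_Pair[OF simple_pattern simple_label_counts[OF simple_xlab]])
  have W: "simple_function \<mu> (\<lambda>z. (xlab z, ylab m z))" by (rule simple_function_Pair[OF simple_xlab simple_ylab])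
  have "real n * branch_entropy \<le> real n * cond_ent \<mu> xlab (ylab m)"
    unfolding cond_ent_labels by (intro mult_left_mono branch_entropy_le simple_function_grid) simp
  also have "\<dots> = real n * ent \<mu> (\<lambda>z. (xlab z, ylab m z)) - real n * ent \<mu> (ylab m)"
    by (simp add: cond_ent_def right_diff_distrib)
  also have "real n * ent \<mu> (\<lambda>z. (xlab z, ylab m z)) = ent smp.Om (\<lambda>\<omega>. restrict (\<lambda>i. (xlab (\<omega> i), ylab m (\<omega> i))) {1..n})"
    using smp.ent_components[OF W] by simp
  also have "\<dots> = ent smp.Om (\<lambda>\<omega>. (?a \<omega>, ?c \<omega>))"
    by (rule smp.om.ent_cong_level) (auto simp: fun_eq_iff restrict_def)
  also have "real n * ent \<mu> (ylab m) = ent smp.Om ?c"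
    using smp.ent_components[OF simple_ylab[of m]] by simp
  also have "ent smp.Om (\<lambda>\<omega>. (?a \<omega>, ?c \<omega>)) \<le> ent smp.Om (\<lambda>\<omega>. (?a \<omega>, (?T \<omega>, ?c \<omega>)))"
    by (intro smp.om.ent_mono simple_function_Pair[OF a c] simple_function_Pair[OF a simple_function_Pair[OF T c]]) simp
  also have "\<dots> = cond_ent smp.Om ?a (\<lambda>\<omega>. (?T \<omega>, ?c \<omega>)) + ent smp.Om (\<lambda>\<omega>. (?T \<omega>, ?c \<omega>))"
    by (simp add: cond_ent_def)
  also have "ent smp.Om (\<lambda>\<omega>. (?T \<omega>, ?c \<omega>)) \<le> ent smp.Om ?T + ent smp.Om ?c"
    by (rule smp.om.ent_pair_le[OF T c])
  also have "ent smp.Om ?T \<le> ent smp.Om (pattern n) + ent smp.Om (label_counts xlab (X 1))"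
    by (rule smp.om.ent_pair_le[OF simple_pattern simple_label_counts[OF simple_xlab]])
  also have "ent smp.Om (label_counts xlab (X 1)) \<le> real (X 1 + 1) * ln (real (n + 1))"
    by (rule ent_label_counts_le[OF simple_xlab])
  also have "cond_ent smp.Om ?a (\<lambda>\<omega>. (?T \<omega>, ?c \<omega>)) \<le>
      - ln (1 - 1 / 2) + measure smp.Om (collision m) * ln (card ?R / (1 / 2))"
  proof (rule smp.om.cond_ent_fano[OF a simple_function_Pair[OF T c] _ _ collision_sets])
    show "finite ?R" by (intro finite_PiE) auto
    show "?a ` space smp.Om \<subseteq> ?R"
      using xlab_le[OF sample_in_space] by (intro image_subsetI restrict_PiE_iff[THEN iffD2] ballI) simp
    fix \<omega> \<omega>' assume w: "\<omega> \<in> space smp.Om - collision m" "\<omega>' \<in> space smp.Om - collision m"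
      and eq: "(?T \<omega>, ?c \<omega>) = (?T \<omega>', ?c \<omega>')"
    have c_eq: "?c \<omega> = ?c \<omega>'" using eq by (simp only: prod.inject)
    have ceq: "ylab m (\<omega> i) = ylab m (\<omega>' i)" if "i \<in> {1..n}" for i
      using fun_cong[OF c_eq, of i] that by (simp only: restrict_apply if_True)
    have hr: "height_rank \<omega> = height_rank \<omega>'"
      by (rule height_rank_determined[of m]) (use w ceq in \<open>auto simp: collision_def\<close>)
    have pat: "pattern n \<omega> = pattern n \<omega>'" and cnt: "label_counts xlab (X 1) \<omega> = label_counts xlab (X 1) \<omega>'"
      using eq by (simp_all only: prod.inject)
    have wS: "\<omega> \<in> space smp.Om" "\<omega>' \<in> space smp.Om" using w by blast+
    have "xlab (\<omega> l) = xlab (\<omega>' l)" if l: "l \<in> {1..n}" for l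
      by (rule antisym[OF xlab_determined[OF wS hr pat cnt l]
            xlab_determined[OF wS(2,1) hr[symmetric] pat[symmetric] cnt[symmetric] l]])
    then show "?a \<omega> = ?a \<omega>'" by (rule restrict_ext)
  qed simp_all
  also have "- ln (1 - 1 / 2) = ln (2 :: real)" by (simp add: ln_div)
  also have "measure smp.Om (collision m) * ln (card ?R / (1 / 2)) \<le> ln (real (X 1 + 1)) + ln 2"
  proof -
    have R: "real (card ?R) / (1 / 2) = real (X 1 + 1) ^ n * 2" by (simp add: card_funcsetE)
    have ln_R: "ln (card ?R / (1 / 2)) = real n * ln (real (X 1 + 1)) + ln 2"
      unfolding R by (subst ln_mult) (simp_all add: ln_realpow)
    have l: "0 \<le> ln (real (X 1 + 1))" by simp
    have "measure smp.Om (collision m) \<le> (real n)\<^sup>2 / real m" by (rule prob_collision[OF m])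
    also have "\<dots> = 1 / real n" using n by (simp add: m_def power2_eq_square power3_eq_cube)
    finally have P: "measure smp.Om (collision m) \<le> 1 / real n" .
    have "measure smp.Om (collision m) * ln (card ?R / (1 / 2)) \<le> 1 / real n * (real n * ln (real (X 1 + 1)) + ln 2)"
      unfolding ln_R using l by (intro mult_right_mono P) simp
    also have "\<dots> = ln (real (X 1 + 1)) + ln 2 / real n" using n by (simp add: field_simps)
    also have "ln 2 / real n \<le> ln 2" using n by (simp add: field_simps)
    finally show ?thesis by simp
  qed
  finally show ?thesis by (simp add: pattern_entropy_eq_ent)
qed

end

theorem (in branched_map) pattern_entropy_tendsto:
  assumes \<mu>: "induced_permuton f \<mu>"
  shows "(\<lambda>n. pattern_entropy \<mu> n / real n) \<longlonglongrightarrow> branch_entropy"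
proof -
  have sm: "sampled_map f X \<mu>"
    by (intro sampled_map.intro sampled_map_axioms.intro branched_map_axioms \<mu>)
  have ln_over: "(\<lambda>n. (a * ln (real (n + 1)) + b) / real n) \<longlonglongrightarrow> 0" for a b :: real
    by real_asymp
  show ?thesis
  proof (rule LIMSEQ_I)
    fix e :: real assume e: "0 < e"
    then have e2: "0 < e / 2" by simp
    obtain m where m: "cond_ent unit_lborel X (\<lambda>x. grid m (f x)) < branch_entropy + e / 2"
      by (rule cond_ent_near_branch_entropy[OF e2])
    define k where "k = real (X 1 + 1)"
    define K where "K = ln 2 + ln k + ln 2"
    have up: "\<forall>\<^sub>F n in sequentially. (real (m + 1) * ln (real (n + 1)) + 0) / real n < e / 2"
      using order_tendstoD(2)[OF ln_over e2] .
    have low: "\<forall>\<^sub>F n in sequentially. (k * ln (real (n + 1)) + K) / real n < e"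
      using order_tendstoD(2)[OF ln_over e] .
    have "\<forall>\<^sub>F n in sequentially. norm (pattern_entropy \<mu> n / real n - branch_entropy) < e"
      using up low eventually_gt_at_top[of 0]
    proof eventually_elim
      case (elim n)
      then have n: "real n > 0" by simp
      have "pattern_entropy \<mu> n / real n \<le>
          (real (m + 1) * ln (real (n + 1)) + real n * cond_ent unit_lborel X (\<lambda>x. grid m (f x))) / real n"
        using sampled_map.pattern_entropy_le[OF sm, of n m] n by (intro divide_right_mono) auto
      also have "\<dots> = (real (m + 1) * ln (real (n + 1)) + 0) / real n + cond_ent unit_lborel X (\<lambda>x. grid m (f x))"
        using n by (simp add: add_divide_distrib)
      finally have 1: "pattern_entropy \<mu> n / real n < branch_entropy + e" using elim(1) m by linarith
      have "real n * branch_entropy / real n \<le> (pattern_entropy \<mu> n + (k * ln (real (n + 1)) + K)) / real n"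
        using sampled_map.pattern_entropy_ge[OF sm, of n] elim(3)
        by (intro divide_right_mono) (auto simp: k_def K_def)
      also have "\<dots> = pattern_entropy \<mu> n / real n + (k * ln (real (n + 1)) + K) / real n"
        by (rule add_divide_distrib)
      finally have "branch_entropy < pattern_entropy \<mu> n / real n + e" using elim(2) n by simp
      with 1 show ?case by (simp add: abs_less_iff)
    qed
    then show "\<exists>N. \<forall>n\<ge>N. norm (pattern_entropy \<mu> n / real n - branch_entropy) < e"
      by (simp add: eventually_sequentially)
  qed
qed

section \<open>Piecewise differentiable maps\<close>

text \<open>If \<open>f\<close> contracted near \<open>x\<close>, then a short interval around \<open>x\<close> would be contained in the preimage of
  a shorter interval, which has the measure of that shorter interval.\<close>

lemma abs_deriv_ge_1:
  assumes mp: "measure_preserving unit_lborel f" and x: "0 < x" "x < 1"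
    and d: "(f has_real_derivative d) (at x)"
  shows "1 \<le> \<bar>d\<bar>"
proof (rule ccontr)
  assume "\<not> 1 \<le> \<bar>d\<bar>"
  define c where "c = (\<bar>d\<bar> + 1) / 2"
  have c: "\<bar>d\<bar> < c" "c < 1" "0 < c" using \<open>\<not> 1 \<le> \<bar>d\<bar>\<close> by (auto simp: c_def)
  interpret mp_system unit_lborel f by unfold_locales (rule mp)
  have "(\<lambda>y. (f y - f x) / (y - x)) \<midarrow>x\<rightarrow> d" using d by (simp add: has_field_derivative_iff)
  then have "\<forall>\<^sub>F y in at x. \<bar>(f y - f x) / (y - x)\<bar> < c"
    using order_tendstoD(2)[OF tendsto_rabs c(1)] by blast
  then obtain r where r: "0 < r" "\<And>y. y \<noteq> x \<Longrightarrow> dist y x < r \<Longrightarrow> \<bar>(f y - f x) / (y - x)\<bar> < c"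
    by (auto simp: eventually_at)
  define h where "h = Min {r / 2, x, 1 - x}"
  have h: "0 < h" "h < r" "h \<le> x" "h \<le> 1 - x"
    using r(1) x by (auto simp: h_def min_def)
  have lip: "\<bar>f y - f x\<bar> \<le> c * h" if "y \<in> {x - h..x + h}" for y
  proof (cases "y = x")
    case False
    have "dist y x \<le> h" using that by (auto simp: dist_real_def)
    then have "\<bar>f y - f x\<bar> < c * \<bar>y - x\<bar>"
      using r(2)[OF False] h(2) False by (simp add: abs_divide field_simps)
    also have "\<dots> \<le> c * h" using \<open>dist y x \<le> h\<close> c by (intro mult_left_mono) (auto simp: dist_real_def)
    finally show ?thesis by simp
  qed (use c h in simp)
  let ?B = "{f x - c * h..f x + c * h} \<inter> {0..1}" and ?J = "{x - h..x + h}"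
  have J: "?J \<subseteq> {0..1}" using h by auto
  have B: "?B \<in> sets unit_lborel" by (auto simp: sets_restrict_space_iff)
  have sub: "?J \<subseteq> f -` ?B \<inter> space unit_lborel"
  proof
    fix y assume y: "y \<in> ?J"
    then have "y \<in> space unit_lborel" using J by (auto simp: space_unit_lborel)
    moreover from this have "f y \<in> {0..1}" using measurable_space[OF T_measurable] by (simp add: space_unit_lborel)
    ultimately show "y \<in> f -` ?B \<inter> space unit_lborel" using lip[OF y] by (auto simp: abs_le_iff)
  qed
  have "ennreal (2 * h) = emeasure unit_lborel ?J"
    using J h by (subst emeasure_restrict_space) auto
  also have "\<dots> \<le> emeasure unit_lborel (f -` ?B \<inter> space unit_lborel)"
    using measurable_sets[OF T_measurable B] sub by (rule emeasure_mono[rotated])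
  also have "\<dots> = emeasure (distr unit_lborel unit_lborel f) ?B"
    by (rule emeasure_distr[OF T_measurable B, symmetric])
  also have "\<dots> = emeasure lborel ?B"
    using B by (subst T_distr, subst emeasure_restrict_space) auto
  also have "\<dots> \<le> emeasure lborel {f x - c * h..f x + c * h}"
    by (rule emeasure_mono) auto
  also have "\<dots> = ennreal (2 * (c * h))" using c h by simp
  finally have "2 * h \<le> 2 * (c * h)" using c h by (simp add: ennreal_le_iff)
  then show False using c h by simp
qed

text \<open>Expansion and strict monotonicity in one; it holds trivially on sets with at most one point.\<close>

definition strictly_expanding_on :: "real set \<Rightarrow> (real \<Rightarrow> real) \<Rightarrow> bool" where
  "strictly_expanding_on S f \<longleftrightarrow>
    (\<forall>x\<in>S. \<forall>y\<in>S. x < y \<longrightarrow> y - x \<le> f y - f x) \<or> (\<forall>x\<in>S. \<forall>y\<in>S. x < y \<longrightarrow> y - x \<le> f x - f y)"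

text \<open>The continuous derivative has absolute value at least \<open>1\<close>, so it keeps its sign on the interval, and
  the mean value theorem applies.\<close>

lemma strictly_expanding_on_interior:
  assumes mp: "measure_preserving unit_lborel f" and I: "is_interval I" "I \<subseteq> {0..1}"
    and C1: "f C1_differentiable_on interior I"
  shows "strictly_expanding_on (interior I) f"
proof -
  let ?J = "interior I"
  have conn: "connected ?J" using I(1) by (intro convex_connected convex_interior is_interval_convex)
  then have seg: "z \<in> ?J" if "x \<in> ?J" "y \<in> ?J" "x \<le> z" "z \<le> y" for x y z
    using that by (meson connectedD_interval)
  obtain D where D: "\<And>x. x \<in> ?J \<Longrightarrow> (f has_real_derivative D x) (at x)" and cont: "continuous_on ?J D"
    using C1 unfolding C1_differentiable_on_def has_real_derivative_iff_has_vector_derivative by blast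
  have J01: "0 < x \<and> x < 1" if "x \<in> ?J" for x
    using interior_mono[OF I(2)] that by auto
  have D1: "1 \<le> \<bar>D x\<bar>" if "x \<in> ?J" for x
    using abs_deriv_ge_1[OF mp _ _ D[OF that]] J01[OF that] by blast
  have mvt: "\<exists>z\<in>?J. f y - f x = (y - x) * D z" if "x \<in> ?J" "y \<in> ?J" "x < y" for x y
  proof -
    have "\<exists>z>x. z < y \<and> f y - f x = (y - x) * D z"
      by (rule MVT2[OF that(3)]) (use that seg D in blast)
    then show ?thesis using that seg by (meson less_imp_le)
  qed
  have "(\<forall>z\<in>?J. 1 \<le> D z) \<or> (\<forall>z\<in>?J. D z \<le> -1)"
  proof (rule ccontr)
    assume "\<not> ?thesis"
    then obtain a b where a: "a \<in> ?J" "\<not> 1 \<le> D a" and b: "b \<in> ?J" "\<not> D b \<le> -1" by blast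
    have ab: "D a \<le> 0" "0 \<le> D b" using D1[OF a(1)] D1[OF b(1)] a(2) b(2) by linarith+
    have "connected (D ` ?J)" by (rule connected_continuous_image[OF cont conn])
    then have "0 \<in> D ` ?J"
      using a b ab connectedD_interval[of "D ` ?J" "D a" "D b" 0] by blast
    then show False using D1 by fastforce
  qed
  then show ?thesis
  proof
    assume pos: "\<forall>z\<in>?J. 1 \<le> D z"
    have "y - x \<le> f y - f x" if xy: "x \<in> ?J" "y \<in> ?J" "x < y" for x y
    proof -
      obtain z where "z \<in> ?J" "f y - f x = (y - x) * D z" using mvt[OF xy] by blast
      then show ?thesis using pos xy(3) mult_left_mono[of 1 "D z" "y - x"] by auto
    qed
    then show ?thesis by (auto simp: strictly_expanding_on_def)
  next
    assume neg: "\<forall>z\<in>?J. D z \<le> -1"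
    have "y - x \<le> f x - f y" if xy: "x \<in> ?J" "y \<in> ?J" "x < y" for x y
    proof -
      obtain z where "z \<in> ?J" "f y - f x = (y - x) * D z" using mvt[OF xy] by blast
      then show ?thesis using neg xy(3) mult_left_mono[of "D z" "-1" "y - x"] by auto
    qed
    then show ?thesis by (auto simp: strictly_expanding_on_def)
  qed
qed

lemma finite_interval_minus_interior:
  fixes I :: "real set"
  assumes "is_interval I"
  shows "finite (I - interior I)"
proof -
  have "I - interior I \<subseteq> {Inf I, Sup I}"
  proof
    fix z assume z: "z \<in> I - interior I"
    have "(\<forall>a\<in>I. z \<le> a) \<or> (\<forall>b\<in>I. b \<le> z)"
    proof (rule ccontr)
      assume "\<not> ?thesis"
      then obtain a b where ab: "a \<in> I" "b \<in> I" "a < z" "z < b" by (auto simp: not_le)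
      have "{a<..<b} \<subseteq> I"
        using assms ab unfolding is_interval_1 by (meson greaterThanLessThan_iff less_imp_le subsetI)
      then have "z \<in> interior I" using ab by (intro interiorI[of "{a<..<b}"]) auto
      then show False using z by blast
    qed
    then show "z \<in> {Inf I, Sup I}"
      using z cInf_eq_minimum[of z I] cSup_eq_maximum[of z I] by auto
  qed
  then show ?thesis by (rule finite_subset) simp
qed

text \<open>The breakpoints, where no bound on the behaviour of \<open>f\<close> is known, become pieces of their own. Counting
  breakpoints both strictly and weakly to the left of \<open>x\<close> gives a monotone numbering that tells a
  breakpoint from its neighbours on either side.\<close>

lemma branched_map_if_piecewise_C1:
  assumes mp: "measure_preserving unit_lborel f" and C1: "piecewise_C1 f"
  obtains X where "branched_map f X"
proof -
  obtain P where P: "finite P" "partition_on {0..1} P"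
    "\<And>I. I \<in> P \<Longrightarrow> is_interval I" "\<And>I. I \<in> P \<Longrightarrow> f C1_differentiable_on interior I"
    using C1 unfolding piecewise_C1_def by blast
  have P01: "I \<subseteq> {0..1}" if "I \<in> P" for I using P(2) that by (auto simp: partition_on_def)
  define E where "E = {0..1} - (\<Union>I\<in>P. interior I)"
  have "E \<subseteq> (\<Union>I\<in>P. I - interior I)" using P(2) unfolding E_def partition_on_def by blast
  then have fin: "finite E"
    by (rule finite_subset) (intro finite_UN_I P(1) finite_interval_minus_interior P(3))
  define X where "X x = card {e \<in> E. e < x} + card {e \<in> E. e \<le> x}" for x :: real
  have mono_lt: "card {e \<in> E. e < x} \<le> card {e \<in> E. e < y}"
    and mono_le: "card {e \<in> E. e \<le> x} \<le> card {e \<in> E. e \<le> y}" if "x \<le> y" for x y :: real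
    using fin that by (auto intro!: card_mono)
  have mono: "mono_on {0..1} X"
    unfolding X_def by (intro mono_onI add_mono mono_lt mono_le)
  have no_break: "{x..y} \<inter> E = {}" if "X x = X y" "x < y" for x y
  proof -
    have "card {e \<in> E. e < x} = card {e \<in> E. e < y}" "card {e \<in> E. e \<le> x} = card {e \<in> E. e \<le> y}"
      using that mono_lt[of x y] mono_le[of x y] by (auto simp: X_def)
    moreover have "{e \<in> E. e < x} \<subseteq> {e \<in> E. e < y}" "{e \<in> E. e \<le> x} \<subseteq> {e \<in> E. e \<le> y}"
      using that(2) by auto
    ultimately have eq: "{e \<in> E. e < x} = {e \<in> E. e < y}" "{e \<in> E. e \<le> x} = {e \<in> E. e \<le> y}"
      using fin by (simp_all add: card_subset_eq)
    have "\<not> (x \<le> e \<and> e \<le> y)" if "e \<in> E" for e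
    proof
      assume e: "x \<le> e \<and> e \<le> y"
      show False
      proof (cases "e < y")
        case True
        then have "e \<in> {e \<in> E. e < x}" unfolding eq(1) using that by simp
        then show False using e by simp
      next
        case False
        then have "e \<in> {e \<in> E. e \<le> x}" unfolding eq(2) using that e by simp
        then show False using False \<open>x < y\<close> by simp
      qed
    qed
    then show ?thesis by auto
  qed
  have same_piece: "y \<in> interior I"
    if "I \<in> P" "x \<in> interior I" "x \<in> {0..1}" "y \<in> {0..1}" "X x = X y" for x y I
  proof (rule ccontr)
    assume y: "y \<notin> interior I"
    let ?S = "{min x y..max x y}" and ?V = "\<Union>I'\<in>P - {I}. interior I'"
    have ne: "x \<noteq> y" using that(2) y by blast
    have "?S \<inter> E = {}"
      using no_break[of x y] no_break[of y x] that(5) ne by (cases "x < y") (auto simp: min_def max_def)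
    moreover have "?S \<subseteq> {0..1}" using that(3,4) by auto
    ultimately have cover: "?S \<subseteq> interior I \<union> ?V" unfolding E_def by blast
    have disj: "interior I \<inter> ?V \<inter> ?S = {}"
    proof -
      have "interior I \<inter> interior I' = {}" if "I' \<in> P - {I}" for I'
        using P(2) that \<open>I \<in> P\<close> interior_subset[of I] interior_subset[of I']
        unfolding partition_on_def disjoint_def by blast
      then show ?thesis by blast
    qed
    have "interior I \<inter> ?S = {} \<or> ?V \<inter> ?S = {}"
      by (rule connectedD[OF connected_Icc open_interior _ disj cover]) (intro open_UN ballI open_interior)
    moreover have "x \<in> interior I \<inter> ?S" using that(2) by simp
    moreover have yS: "y \<in> ?S" by simp
    moreover have "y \<in> ?V" using subsetD[OF cover yS] y by (meson UnE)
    ultimately show False by blast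
  qed
  have expanding: "strictly_expanding_on {z \<in> {0..1}. X z = a} f" for a
  proof (cases "\<exists>I\<in>P. \<exists>x\<in>interior I. x \<in> {0..1} \<and> X x = a")
    case True
    then obtain I x where I: "I \<in> P" "x \<in> interior I" "x \<in> {0..1}" "X x = a" by blast
    have "{z \<in> {0..1}. X z = a} \<subseteq> interior I" using same_piece[OF I(1-3)] I(4) by auto
    moreover have "strictly_expanding_on (interior I) f"
      by (intro strictly_expanding_on_interior mp P I P01)
    ultimately show ?thesis unfolding strictly_expanding_on_def by (meson subsetD)
  next
    case False
    have "x \<in> E" if "x \<in> {0..1}" "X x = a" for x using False that by (auto simp: E_def)
    then have "\<not> x < y" if "x \<in> {0..1}" "X x = a" "y \<in> {0..1}" "X y = a" for x y
      using no_break[of x y] that by fastforce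
    then show ?thesis by (auto simp: strictly_expanding_on_def)
  qed
  have "branched_map f X"
  proof
    show "monotone_on {x \<in> {0..1}. X x = a} (<) (<) f \<or> monotone_on {x \<in> {0..1}. X x = a} (<) (>) f" for a
      using expanding[of a] unfolding strictly_expanding_on_def monotone_on_def
      by (smt (verit))
    have gap: "v - u \<le> \<bar>f u - f v\<bar>" if "u \<in> {0..1}" "v \<in> {0..1}" "X u = X v" "u < v" for u v
    proof -
      let ?S = "{z \<in> {0..1}. X z = X u}"
      have S: "u \<in> ?S" "v \<in> ?S" using that by simp_all
      have "(\<forall>x\<in>?S. \<forall>y\<in>?S. x < y \<longrightarrow> y - x \<le> f y - f x) \<or> (\<forall>x\<in>?S. \<forall>y\<in>?S. x < y \<longrightarrow> y - x \<le> f x - f y)"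
        using expanding[of "X u"] by (simp only: strictly_expanding_on_def)
      then show ?thesis
      proof
        assume inc: "\<forall>x\<in>?S. \<forall>y\<in>?S. x < y \<longrightarrow> y - x \<le> f y - f x"
        show ?thesis using bspec[OF bspec[OF inc S(1)] S(2)] that(4) by linarith
      next
        assume dec: "\<forall>x\<in>?S. \<forall>y\<in>?S. x < y \<longrightarrow> y - x \<le> f x - f y"
        show ?thesis using bspec[OF bspec[OF dec S(1)] S(2)] that(4) by linarith
      qed
    qed
    fix x y :: real assume xy: "x \<in> {0..1}" "y \<in> {0..1}" "X x = X y"
    show "\<bar>x - y\<bar> \<le> \<bar>f x - f y\<bar>"
    proof (cases x y rule: linorder_cases)
      case less
      then show ?thesis using gap[OF xy less] by simp
    next
      case greater
      then show ?thesis using gap[OF xy(2,1) xy(3)[symmetric] greater] by (simp add: abs_minus_commute)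
    qed simp
  qed (rule mp, rule mono)
  then show ?thesis by (rule that)
qed

theorem corollary1p3:
  fixes f :: "real \<Rightarrow> real" and \<mu> :: "(real \<times> real) measure"
  assumes "measure_preserving unit_lborel f"
    and "piecewise_C1 f"
    and "bounded_derivative f"
    and "induced_permuton f \<mu>"
  shows "(\<lambda>n. ereal (pattern_entropy \<mu> n / real n)) \<longlonglongrightarrow> KS_entropy unit_lborel f"
proof -
  obtain X where X: "branched_map f X"
    using assms(1,2) by (rule branched_map_if_piecewise_C1)
  have "(\<lambda>n. pattern_entropy \<mu> n / real n) \<longlonglongrightarrow> branched_map.branch_entropy f X"
    by (rule branched_map.pattern_entropy_tendsto[OF X assms(4)])
  then show ?thesis
    unfolding branched_map.KS_entropy_eq_branch_entropy[OF X] by (rule tendsto_ereal)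
qed

end
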